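(* Let $n,m$ be natural numbers with $1<n<m-1$. The complex $\mathcal{VR}(\mathcal{F}_n^m, 2)$ is homotopy equivalent to a wedge sum of $$\sum_{k=2}^n\binom{m+k-1-n}{k+1}\binom{k}{2}$$ copies of $S^2$.
   Context: $[m]=\{1,\dots,m\}$. Any collection of subsets of $[m]$ is a finite metric space with $d(A,B)=|A\Delta B|$ (size of the symmetric difference). $\mathcal{F}_n^m$ is the collection of all subsets of $[m]$ of size $n$. For a metric space $X$ and $r\ge 0$, the Vietoris-Rips complex $\mathcal{VR}(X,r)$ is the simplicial complex with vertex set $X$ whose simplices are the nonempty finite subsets of $X$ of diameter at most $r$. Homotopy equivalence refers to geometric realizations. *)

theory Defs
  imports "HOL-Analysis.Analysis"
begin

definition set_distance :: "'a set \<Rightarrow> 'a set \<Rightarrow> real" where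
  "set_distance A B = real (card (sym_diff A B))"

definition subsets_of_size :: "nat \<Rightarrow> nat \<Rightarrow> nat set set" where
  "subsets_of_size n m = {A. A \<subseteq> {1..m} \<and> card A = n}"

text \<open>A metric space is given by a carrier and a distance function, as in the locale
  \<^locale>\<open>Metric_space\<close>. For a finite set the supremum below is the maximum of the distances.\<close>

definition metric_diameter :: "('a \<Rightarrow> 'a \<Rightarrow> real) \<Rightarrow> 'a set \<Rightarrow> real" where
  "metric_diameter d S = (if S = {} then 0 else SUP (x,y)\<in>S\<times>S. d x y)"

definition vietoris_rips :: "'a set \<Rightarrow> ('a \<Rightarrow> 'a \<Rightarrow> real) \<Rightarrow> real \<Rightarrow> 'a set set" where
  "vietoris_rips X d r =
     {\<sigma>. \<sigma> \<noteq> {} \<and> finite \<sigma> \<and> \<sigma> \<subseteq> X \<and> metric_diameter d \<sigma> \<le> r}"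

text \<open>An abstract simplicial complex is represented by the set of its (nonempty, finite)
  simplices. Points of its realization are given by barycentric coordinates; the topology
  is the weak one: a set is open iff it meets every closed simplex in a
  relatively open set.\<close>

definition closed_simplex :: "'a set \<Rightarrow> ('a \<Rightarrow> real) set" where
  "closed_simplex \<sigma> = {t. (\<forall>v. 0 \<le> t v) \<and> (\<forall>v. v \<notin> \<sigma> \<longrightarrow> t v = 0) \<and> (\<Sum>v\<in>\<sigma>. t v) = 1}"

definition geometric_realization :: "'a set set \<Rightarrow> ('a \<Rightarrow> real) topology" where
  "geometric_realization K =
     topology (\<lambda>U. U \<subseteq> (\<Union>\<sigma>\<in>K. closed_simplex \<sigma>) \<and>
       (\<forall>\<sigma>\<in>K. openin (top_of_set (closed_simplex \<sigma>)) (U \<inter> closed_simplex \<sigma>)))"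

lemma openin_geometric_realization:
  "openin (geometric_realization K) U \<longleftrightarrow>
     U \<subseteq> (\<Union>\<sigma>\<in>K. closed_simplex \<sigma>) \<and>
     (\<forall>\<sigma>\<in>K. openin (top_of_set (closed_simplex \<sigma>)) (U \<inter> closed_simplex \<sigma>))"
proof -
  let ?L = "\<lambda>U. U \<subseteq> (\<Union>\<sigma>\<in>K. closed_simplex \<sigma>) \<and>
       (\<forall>\<sigma>\<in>K. openin (top_of_set (closed_simplex \<sigma>)) (U \<inter> closed_simplex \<sigma>))"
  have "?L (S \<inter> T)" if "?L S" "?L T" for S T
  proof -
    have "S \<inter> T \<inter> C = (S \<inter> C) \<inter> (T \<inter> C)" for C
      by auto
    then show ?thesis
      using that by (metis (no_types, lifting) openin_Int le_infI1)
  qed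
  moreover have "?L (\<Union>\<K>)" if "\<forall>S\<in>\<K>. ?L S" for \<K>
  proof -
    have "\<Union>\<K> \<inter> C = \<Union>((\<lambda>S. S \<inter> C) ` \<K>)" for C
      by auto
    moreover have "openin (top_of_set (closed_simplex \<sigma>)) (\<Union>((\<lambda>S. S \<inter> closed_simplex \<sigma>) ` \<K>))"
      if "\<sigma> \<in> K" for \<sigma>
      using that \<open>\<forall>S\<in>\<K>. ?L S\<close> by (intro openin_Union) auto
    ultimately show ?thesis
      using that by (simp add: Sup_le_iff)
  qed
  ultimately have "istopology ?L"
    unfolding istopology_def by blast
  then show ?thesis
    by (simp add: geometric_realization_def)
qed

text \<open>The wedge sum of a family of pointed spaces \<open>(X i, p i)\<close> is the quotient of their disjoint
  sum that identifies all base points. The value \<^term>\<open>None\<close> is the common base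
  point; it belongs to the space even if the family is empty, so that the empty wedge is
  a point.\<close>

definition wedge_map :: "('i \<Rightarrow> 'a) \<Rightarrow> 'i \<times> 'a \<Rightarrow> ('i \<times> 'a) option" where
  "wedge_map p = (\<lambda>(i,x). if x = p i then None else Some (i,x))"

definition wedge_sum :: "('i \<Rightarrow> 'a topology) \<Rightarrow> ('i \<Rightarrow> 'a) \<Rightarrow> 'i set \<Rightarrow> ('i \<times> 'a) option topology" where
  "wedge_sum X p I =
     topology (\<lambda>U. U \<subseteq> insert None (wedge_map p ` topspace (sum_topology X I)) \<and>
       openin (sum_topology X I) {z \<in> topspace (sum_topology X I). wedge_map p z \<in> U})"

lemma openin_wedge_sum:
  "openin (wedge_sum X p I) U \<longleftrightarrow>
     U \<subseteq> insert None (wedge_map p ` topspace (sum_topology X I)) \<and>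
     openin (sum_topology X I) {z \<in> topspace (sum_topology X I). wedge_map p z \<in> U}"
proof -
  let ?Y = "sum_topology X I"
  let ?pre = "\<lambda>U. {z \<in> topspace ?Y. wedge_map p z \<in> U}"
  let ?L = "\<lambda>U. U \<subseteq> insert None (wedge_map p ` topspace ?Y) \<and> openin ?Y (?pre U)"
  have "?L (S \<inter> T)" if "?L S" "?L T" for S T
  proof -
    have "?pre (S \<inter> T) = ?pre S \<inter> ?pre T"
      by auto
    then show ?thesis
      using that by (metis (no_types, lifting) openin_Int le_infI1)
  qed
  moreover have "?L (\<Union>\<K>)" if "\<forall>S\<in>\<K>. ?L S" for \<K>
  proof -
    have "?pre (\<Union>\<K>) = \<Union>(?pre ` \<K>)"
      by auto
    moreover have "openin ?Y (\<Union>(?pre ` \<K>))"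
      using that by (intro openin_Union) auto
    ultimately show ?thesis
      using that by (simp add: Sup_le_iff)
  qed
  ultimately have "istopology ?L"
    unfolding istopology_def by blast
  then show ?thesis
    by (simp add: wedge_sum_def)
qed

definition nsphere_base :: "nat \<Rightarrow> real" where
  "nsphere_base = (\<lambda>i. if i = 0 then 1 else 0)"

definition wedge_of_spheres :: "nat \<Rightarrow> nat \<Rightarrow> (nat \<times> (nat \<Rightarrow> real)) option topology" where
  "wedge_of_spheres N p = wedge_sum (\<lambda>_. nsphere p) (\<lambda>_. nsphere_base) {..<N}"

end

theory Submission
  imports Defs
begin

text \<open>Write \<open>B - x\<close> for the vertex obtained from an \<open>(n + 1)\<close>-subset \<open>B\<close> of \<open>[m]\<close> by deleting \<open>x \<in> B\<close>.
  A simplex whose vertices do not all contain a common \<open>(n - 1)\<close>-set consists of such deletions of one \<open>B\<close>.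
  Collapsing the triangles \<open>{B - a, B - b, B - c}\<close>, \<open>a > b > c\<close>, for which \<open>b\<close> is not the predecessor of
  \<open>a\<close> in \<open>B\<close> makes all remaining triangles of this kind maximal. Call one of them critical if some element
  of \<open>[m]\<close> above \<open>a\<close> is missing from \<open>B\<close>. Without the critical triangles the complex is contractible: for
  \<open>q = m, m - 1, \<dots>, m - n + 1\<close> in turn, it collapses onto the simplices whose vertices all contain \<open>q\<close>.
  Shrinking this contractible subcomplex to a point turns each critical triangle into a 2-sphere.
  In the count, the largest element of \<open>[m]\<close> missing from \<open>B\<close> is \<open>m + k - n\<close>; below it \<open>B\<close> has \<open>k + 1\<close> elements,
  and \<open>{b, c}\<close> is any pair of these other than the largest one.\<close>

section \<open>Finite simplicial complexes and collapses\<close>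

text \<open>Every clique lies in one of two kinds: all \<open>n\<close>-sets containing a fixed
  \<open>(n - 1)\<close>-set, or all deletions of a fixed \<open>(n + 1)\<close>-set
  \<open>B\<close>. Cliques of different kinds share at most an edge. Hence, in the simplex of all
  deletions of \<open>B\<close>, faces of dimension at least two can be removed without regard to
  the rest of the complex, whereas edges cannot. What is left of that simplex is its 1-skeleton with
  one triangle for each pair \<open>{b, c}\<close> that avoids the largest element of
  \<open>B\<close>. Being a collapse of a simplex, it is contractible. Criticality is dictated by
  the sweep over \<open>q\<close>, whose stage \<open>q\<close> must remove the vertices that miss
  \<open>q\<close>. A triangle with \<open>a < q\<close> and \<open>q \<notin> B\<close> consists of
  such vertices only and would block this stage; every critical triangle does so when
  \<open>q\<close> is the largest element missing from \<open>B\<close>. A triangle with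
  \<open>a = q\<close> and all larger elements in \<open>B\<close> has just one such vertex,
  \<open>B - {q}\<close>, and disappears with it. The sweep ends at \<open>q = m - n + 1\<close>
  because then only the set of the \<open>n\<close> largest elements is left as a vertex.\<close>

definition finite_complex :: "'a set set \<Rightarrow> bool" where
  "finite_complex K \<longleftrightarrow> finite K \<and> (\<forall>\<sigma>\<in>K. finite \<sigma> \<and> \<sigma> \<noteq> {}) \<and>
     (\<forall>\<sigma>\<in>K. \<forall>\<rho>. \<rho> \<subseteq> \<sigma> \<and> \<rho> \<noteq> {} \<longrightarrow> \<rho> \<in> K)"

definition polyhedron :: "'a set set \<Rightarrow> ('a \<Rightarrow> real) set" where
  "polyhedron K = (\<Union>\<sigma>\<in>K. closed_simplex \<sigma>)"

lemma finite_complex_finite: "finite_complex K \<Longrightarrow> finite K"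
  and finite_complex_finite_simplex: "finite_complex K \<Longrightarrow> \<sigma> \<in> K \<Longrightarrow> finite \<sigma>"
  and finite_complex_nonempty: "finite_complex K \<Longrightarrow> \<sigma> \<in> K \<Longrightarrow> \<sigma> \<noteq> {}"
  and finite_complex_face: "finite_complex K \<Longrightarrow> \<sigma> \<in> K \<Longrightarrow> \<rho> \<subseteq> \<sigma> \<Longrightarrow> \<rho> \<noteq> {} \<Longrightarrow> \<rho> \<in> K"
  unfolding finite_complex_def by blast+

lemma finite_complex_avoiding:
  assumes "finite_complex K"
  shows "finite_complex {\<rho> \<in> K. \<forall>t\<in>T. \<not> t \<subseteq> \<rho>}"
  using assms unfolding finite_complex_def by simp (meson subset_trans)

text \<open>The support of a point is the smallest simplex carrying it. Membership in a subcomplex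
  thus becomes a question about one set, without a choice of simplex.\<close>

lemma polyhedron_iff:
  assumes "finite_complex K"
  shows "p \<in> polyhedron K \<longleftrightarrow> (\<forall>v. 0 \<le> p v) \<and> {v. p v \<noteq> 0} \<in> K \<and> sum p {v. p v \<noteq> 0} = 1"
proof
  assume "p \<in> polyhedron K"
  then obtain \<sigma> where \<sigma>: "\<sigma> \<in> K" "\<And>v. 0 \<le> p v" "\<And>v. v \<notin> \<sigma> \<Longrightarrow> p v = 0" "sum p \<sigma> = 1"
    unfolding polyhedron_def closed_simplex_def by auto
  then have fin: "finite \<sigma>"
    using assms finite_complex_finite_simplex by blast
  have sub: "{v. p v \<noteq> 0} \<subseteq> \<sigma>"
    using \<sigma>(3) by blast
  have eq: "sum p {v. p v \<noteq> 0} = 1"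
    using sum.mono_neutral_left[OF fin sub, of p] \<sigma>(4) by auto
  then have "{v. p v \<noteq> 0} \<noteq> {}"
    by force
  then show "(\<forall>v. 0 \<le> p v) \<and> {v. p v \<noteq> 0} \<in> K \<and> sum p {v. p v \<noteq> 0} = 1"
    using finite_complex_face[OF assms \<sigma>(1) sub] \<sigma>(2) eq by blast
next
  assume "(\<forall>v. 0 \<le> p v) \<and> {v. p v \<noteq> 0} \<in> K \<and> sum p {v. p v \<noteq> 0} = 1"
  then show "p \<in> polyhedron K"
    unfolding polyhedron_def closed_simplex_def by auto
qed

lemma polyhedronI:
  assumes "\<sigma> \<in> K" "\<And>v. 0 \<le> p v" "\<And>v. v \<notin> \<sigma> \<Longrightarrow> p v = 0" "sum p \<sigma> = 1"
  shows "p \<in> polyhedron K"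
  using assms unfolding polyhedron_def closed_simplex_def by auto

lemma polyhedron_mono: "K \<subseteq> L \<Longrightarrow> polyhedron K \<subseteq> polyhedron L"
  unfolding polyhedron_def by auto

lemma continuous_on_coordinate: "continuous_on S (\<lambda>p. p v :: real)"
  by (rule continuous_on_subset[OF continuous_on_product_coordinates]) simp

lemma closed_closed_simplex: "closed (closed_simplex \<sigma>)"
proof -
  have "closed_simplex \<sigma> = (\<Inter>v. {t. 0 \<le> t v}) \<inter> (\<Inter>v\<in>-\<sigma>. {t. t v = 0}) \<inter> {t. sum t \<sigma> = 1}"
    unfolding closed_simplex_def by auto
  moreover have "closed {t::'a \<Rightarrow> real. 0 \<le> t v}" "closed {t::'a \<Rightarrow> real. t v = 0}" for v
    by (auto intro!: closed_Collect_le closed_Collect_eq continuous_intros continuous_on_coordinate)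
  moreover have "closed {t::'a \<Rightarrow> real. sum t \<sigma> = 1}"
    by (auto intro!: closed_Collect_eq continuous_intros continuous_on_coordinate)
  ultimately show ?thesis
    by (simp add: closed_INT closed_Int)
qed

lemma compact_closed_simplex:
  assumes "finite \<sigma>"
  shows "compact (closed_simplex \<sigma>)"
proof -
  \<comment> \<open>The index type may be infinite, so the compactness of the cube is Tychonoff's
    theorem.\<close>
  have "compactin (product_topology (\<lambda>_. euclidean) UNIV) (PiE UNIV (\<lambda>_::'a. {0..1::real}))"
    unfolding compactin_PiE by simp
  then have "compact (PiE UNIV (\<lambda>_::'a. {0..1::real}))"
    by (simp add: euclidean_product_topology)
  moreover have "closed_simplex \<sigma> \<subseteq> PiE UNIV (\<lambda>_::'a. {0..1::real})"
  proof
    fix t :: "'a \<Rightarrow> real"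
    assume t: "t \<in> closed_simplex \<sigma>"
    have "t v \<le> 1" for v
    proof (cases "v \<in> \<sigma>")
      case True
      then have "t v \<le> sum t \<sigma>"
        using t assms unfolding closed_simplex_def by (intro member_le_sum) auto
      then show ?thesis
        using t unfolding closed_simplex_def by auto
    qed (use t in \<open>auto simp: closed_simplex_def\<close>)
    then show "t \<in> PiE UNIV (\<lambda>_. {0..1})"
      using t unfolding closed_simplex_def by auto
  qed
  ultimately show ?thesis
    by (metis closed_closed_simplex compact_Int_closed inf.absorb_iff2)
qed

text \<open>Finitely many simplices, each closed in the function space, make the weak topology agree
  with the subspace topology. From here on \<open>continuous_on\<close> can be used.\<close>

lemma geometric_realization_finite:
  assumes "finite_complex K"
  shows "geometric_realization K = top_of_set (polyhedron K)"
  unfolding topology_eq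
proof (intro allI iffI)
  fix U
  assume U: "openin (geometric_realization K) U"
  have "closed (closed_simplex \<sigma> - U)" if "\<sigma> \<in> K" for \<sigma>
  proof -
    have "openin (top_of_set (closed_simplex \<sigma>)) (U \<inter> closed_simplex \<sigma>)"
      using U that by (simp add: openin_geometric_realization)
    then have "closedin (top_of_set (closed_simplex \<sigma>)) (closed_simplex \<sigma> - U \<inter> closed_simplex \<sigma>)"
      by (metis closedin_diff closedin_subtopology_refl subset_UNIV topspace_euclidean)
    then show ?thesis
      by (simp add: Diff_Int closedin_closed_trans closed_closed_simplex)
  qed
  then have "closed (\<Union>\<sigma>\<in>K. closed_simplex \<sigma> - U)"
    by (intro closed_UN finite_complex_finite[OF assms] ballI)
  moreover have "U = polyhedron K \<inter> - (\<Union>\<sigma>\<in>K. closed_simplex \<sigma> - U)"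
    using U unfolding openin_geometric_realization polyhedron_def by blast
  ultimately show "openin (top_of_set (polyhedron K)) U"
    by (metis open_Compl openin_open_Int)
next
  fix U
  assume "openin (top_of_set (polyhedron K)) U"
  then obtain W where W: "open W" "U = polyhedron K \<inter> W"
    by (auto simp: openin_open)
  have "U \<inter> closed_simplex \<sigma> = closed_simplex \<sigma> \<inter> W" if "\<sigma> \<in> K" for \<sigma>
    using that W(2) unfolding polyhedron_def by auto
  then show "openin (geometric_realization K) U"
    using W unfolding openin_geometric_realization polyhedron_def by auto
qed

section \<open>Elementary collapses\<close>

lemma continuous_on_Min_coordinates:
  assumes "finite \<sigma>" "\<sigma> \<noteq> {}"
  shows "continuous_on S (\<lambda>p. Min (p ` \<sigma>) :: real)"
  using assms
proof (induction rule: finite_ne_induct)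
  case (singleton x)
  then show ?case by (simp add: continuous_on_coordinate)
next
  case (insert x F)
  have "Min (p ` insert x F) = min (p x) (Min (p ` F))" for p :: "'a \<Rightarrow> real"
    using insert by (simp add: Min_insert)
  then show ?case
    using insert by (auto intro!: continuous_intros continuous_on_coordinate)
qed

text \<open>The deformation moves the common part of the \<open>\<sigma>\<close>-coordinates, i.e. their minimum \<open>\<mu>\<close>, to \<open>v\<close>.
  As \<open>\<mu>\<close> vanishes outside the simplices containing \<open>\<sigma>\<close>, one formula serves for all simplices.\<close>

lemma homotopy_equivalent_collapse:
  assumes K: "finite_complex K" and \<sigma>: "finite \<sigma>" "\<sigma> \<noteq> {}" and v: "v \<notin> \<sigma>"
    and cone: "\<And>\<rho>. \<rho> \<in> K \<Longrightarrow> \<sigma> \<subseteq> \<rho> \<Longrightarrow> insert v \<rho> \<in> K"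
  shows "top_of_set (polyhedron K) homotopy_equivalent_space
         top_of_set (polyhedron {\<rho> \<in> K. \<not> \<sigma> \<subseteq> \<rho>})"
proof -
  let ?L = "{\<rho> \<in> K. \<not> \<sigma> \<subseteq> \<rho>}"
  have L: "finite_complex ?L"
    using finite_complex_avoiding[OF K, of "{\<sigma>}"] by simp
  define \<mu> where "\<mu> = (\<lambda>p :: 'a \<Rightarrow> real. Min (p ` \<sigma>))"
  \<comment> \<open>The entries of \<open>e\<close> sum to zero: \<open>card \<sigma>\<close> at
    \<open>v\<close> balances \<open>-1\<close> at each vertex of \<open>\<sigma>\<close>. So
    \<open>F\<close> preserves the total weight 1.\<close>
  define e where "e = (\<lambda>x. if x = v then real (card \<sigma>) else if x \<in> \<sigma> then -1 else 0)"
  define F where "F = (\<lambda>(t, p :: 'a \<Rightarrow> real) x. p x + t * \<mu> p * e x)"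
  have contF: "continuous_on S F" for S
  proof (rule continuous_on_coordinatewise_then_product)
    fix x
    have "continuous_on S (\<lambda>q. \<mu> (snd q))"
      unfolding \<mu>_def
      by (rule continuous_on_compose2[OF continuous_on_Min_coordinates[OF \<sigma>, of UNIV]])
        (auto intro: continuous_intros)
    moreover have "continuous_on S (\<lambda>q. snd q x)"
      by (rule continuous_on_compose2[OF continuous_on_coordinate[of UNIV]])
        (auto intro: continuous_intros)
    ultimately show "continuous_on S (\<lambda>q. F q x)"
      unfolding F_def case_prod_unfold by (intro continuous_intros)
  qed
  have \<mu>0: "\<mu> p = 0" if p: "\<And>x. 0 \<le> p x" and "\<not> \<sigma> \<subseteq> {x. p x \<noteq> 0}" for p
  proof -
    have "0 \<in> p ` \<sigma>"
      using that(2) by force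
    then show ?thesis
      unfolding \<mu>_def using \<sigma> p by (intro Min_eqI) auto
  qed
  have \<mu>_le: "\<mu> p \<le> p x" if "x \<in> \<sigma>" for p x
    unfolding \<mu>_def using \<sigma> that by simp
  have \<mu>_ge: "0 \<le> \<mu> p" if "\<And>x. 0 \<le> p x" for p
    unfolding \<mu>_def using \<sigma> that by (subst Min_ge_iff) auto
  have F_nonneg: "0 \<le> F (t, p) x" if "\<And>x. 0 \<le> p x" "0 \<le> t" "t \<le> 1" for t p x
  proof (cases "x = v \<or> x \<notin> \<sigma>")
    case True
    then show ?thesis
      unfolding F_def e_def using that \<mu>_ge[of p] by auto
  next
    case False
    then have "t * \<mu> p \<le> 1 * p x"
      using that \<mu>_ge[of p] \<mu>_le[of x p] by (intro mult_mono) auto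
    then show ?thesis
      unfolding F_def e_def using False by auto
  qed
  have F_main: "F (t, p) \<in> polyhedron K" "t = 1 \<Longrightarrow> F (t, p) \<in> polyhedron ?L"
    if p: "p \<in> polyhedron K" and t: "0 \<le> t" "t \<le> 1" for t p
  proof -
    let ?S = "{x. p x \<noteq> 0}"
    have p': "\<And>x. 0 \<le> p x" "?S \<in> K" "sum p ?S = 1"
      using p by (auto simp: polyhedron_iff[OF K])
    have "F (t, p) \<in> polyhedron K \<and> (t = 1 \<longrightarrow> F (t, p) \<in> polyhedron ?L)"
    proof (cases "\<sigma> \<subseteq> ?S")
      case False
      then have "F (t, p) = p"
        unfolding F_def using \<mu>0[OF p'(1)] by auto
      moreover have "p \<in> polyhedron ?L"
        using False p' by (simp add: polyhedron_iff[OF L])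
      ultimately show ?thesis
        using p by auto
    next
      case True
      let ?R = "insert v ?S"
      have R: "?R \<in> K"
        using cone True p'(2) by blast
      have fin: "finite ?R"
        using finite_complex_finite_simplex[OF K R] .
      have out: "F (t, p) x = 0" if "x \<notin> ?R" for x
        using that True unfolding F_def e_def by auto
      have "sum e ?R = sum e (insert v \<sigma>)"
        by (rule sum.mono_neutral_right) (use True fin in \<open>auto simp: e_def\<close>)
      also have "\<dots> = e v + sum e \<sigma>"
        using \<sigma> v by simp
      also have "sum e \<sigma> = (\<Sum>x\<in>\<sigma>. - 1)"
        by (rule sum.cong) (use v in \<open>auto simp: e_def\<close>)
      finally have e0: "sum e ?R = 0"
        by (simp add: e_def)
      have p1: "sum p ?R = 1"
        using p'(3) sum.mono_neutral_left[of ?R ?S p] fin by (metis (mono_tags, lifting) DiffD2 mem_Collect_eq subset_insertI)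
      have "sum (F (t, p)) ?R = sum p ?R + t * \<mu> p * sum e ?R"
        unfolding F_def by (simp add: sum.distrib sum_distrib_left)
      then have sum1: "sum (F (t, p)) ?R = 1"
        using e0 p1 by simp
      have mem: "F (t, p) \<in> polyhedron K"
        using R F_nonneg[OF p'(1) t] out sum1 by (rule polyhedronI)
      moreover have "F (t, p) \<in> polyhedron ?L" if "t = 1"
      proof -
        \<comment> \<open>A vertex of \<open>\<sigma>\<close> where the minimum is attained has
          coordinate 0 at time 1, so the support no longer contains \<open>\<sigma>\<close>.\<close>
        have "\<mu> p \<in> p ` \<sigma>"
          unfolding \<mu>_def using \<sigma> by simp
        then obtain x where x: "x \<in> \<sigma>" "p x = \<mu> p"
          by auto
        then have "F (t, p) x = 0"
          using v that unfolding F_def e_def by auto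
        then have "\<not> \<sigma> \<subseteq> {x. F (t, p) x \<noteq> 0}"
          using x by blast
        then show ?thesis
          using mem unfolding polyhedron_iff[OF K] polyhedron_iff[OF L] by blast
      qed
      ultimately show ?thesis
        by blast
    qed
    then show "F (t, p) \<in> polyhedron K" "t = 1 \<Longrightarrow> F (t, p) \<in> polyhedron ?L"
      by auto
  qed
  have F0: "F (0, p) = p" for p
    unfolding F_def by simp
  have F_fix: "F (t, p) = p" if "p \<in> polyhedron ?L" for t p
    using that \<mu>0[of p] unfolding polyhedron_iff[OF L] F_def by auto
  have sub: "polyhedron ?L \<subseteq> polyhedron K"
    unfolding polyhedron_def by auto
  have "homotopic_with (\<lambda>x. True) (top_of_set (polyhedron K)) (top_of_set (polyhedron K)) id (\<lambda>p. F (1, p))"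
    unfolding homotopic_with_def
  proof (intro exI conjI allI ballI)
    show "continuous_map (prod_topology (top_of_set {0..1}) (top_of_set (polyhedron K)))
            (top_of_set (polyhedron K)) F"
      using contF F_main(1) by (auto simp: prod_topology_subtopology_eu)
  qed (auto simp: F0)
  then have hom: "homotopic_with (\<lambda>x. True) (top_of_set (polyhedron K)) (top_of_set (polyhedron K))
      (\<lambda>p. F (1, p)) id"
    by (rule homotopic_with_symD)
  have "continuous_on (polyhedron K) (\<lambda>p. F (1, p))"
    by (rule continuous_on_compose2[OF contF[of UNIV]]) (auto intro!: continuous_intros)
  then have "retraction_maps (top_of_set (polyhedron K)) (top_of_set (polyhedron ?L)) (\<lambda>p. F (1, p)) id"
    unfolding retraction_maps_def using F_main(2) F_fix sub by (auto simp: continuous_on_id)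
  then show ?thesis
    using hom deformation_retract_imp_homotopy_equivalent_space by blast
qed

text \<open>The simplices containing some \<open>t \<in> T\<close> are removed in the order of decreasing \<open>key t\<close>.
  The last alternative allows \<open>insert v \<rho>\<close> to contain a \<open>t'\<close> removed before \<open>t\<close>, provided that
  \<open>\<rho>\<close> itself has already disappeared at that time.\<close>

lemma homotopy_equivalent_collapse_family:
  fixes key :: "'a set \<Rightarrow> nat"
  assumes K: "finite_complex K" and T: "finite T" "\<And>t. t \<in> T \<Longrightarrow> finite t \<and> t \<noteq> {}"
    and cone: "\<And>t. t \<in> T \<Longrightarrow> \<exists>v. v \<notin> t \<and> (\<forall>\<rho>\<in>K. t \<subseteq> \<rho> \<longrightarrow> insert v \<rho> \<in> K \<and>
       (\<forall>t'\<in>T. key t \<le> key t' \<longrightarrow> t' \<subseteq> insert v \<rho> \<longrightarrow> t' \<subseteq> \<rho> \<or> (\<exists>t''\<in>T. t'' \<subseteq> \<rho> \<and> key t < key t'')))"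
  shows "top_of_set (polyhedron K) homotopy_equivalent_space
         top_of_set (polyhedron {\<rho> \<in> K. \<forall>t\<in>T. \<not> t \<subseteq> \<rho>})"
  using T cone
proof (induction "card T" arbitrary: T)
  case 0
  then show ?case
    by (simp add: homotopy_equivalent_space_refl)
next
  case (Suc n)
  have "T \<noteq> {}"
    using Suc.hyps(2) by auto
  \<comment> \<open>The induction splits off a member of smallest key, which is the last one to be
    removed.\<close>
  define k where "k = Min (key ` T)"
  have "k \<in> key ` T"
    unfolding k_def using Suc.prems(1) \<open>T \<noteq> {}\<close> by simp
  then obtain t where t: "t \<in> T" "key t = k"
    by auto
  have tmin: "key t \<le> key t'" if "t' \<in> T" for t'
    using that Suc.prems(1) t(2) unfolding k_def by simp
  let ?T = "T - {t}"
  let ?K = "{\<rho> \<in> K. \<forall>t\<in>?T. \<not> t \<subseteq> \<rho>}"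
  have "n = card ?T"
    using Suc.hyps(2) t(1) by simp
  moreover have "\<exists>v. v \<notin> s \<and> (\<forall>\<rho>\<in>K. s \<subseteq> \<rho> \<longrightarrow> insert v \<rho> \<in> K \<and>
       (\<forall>t'\<in>?T. key s \<le> key t' \<longrightarrow> t' \<subseteq> insert v \<rho> \<longrightarrow> t' \<subseteq> \<rho> \<or> (\<exists>t''\<in>?T. t'' \<subseteq> \<rho> \<and> key s < key t'')))"
    if s: "s \<in> ?T" for s
  proof -
    have "s \<in> T"
      using s by simp
    then obtain v where v: "v \<notin> s \<and> (\<forall>\<rho>\<in>K. s \<subseteq> \<rho> \<longrightarrow> insert v \<rho> \<in> K \<and>
       (\<forall>t'\<in>T. key s \<le> key t' \<longrightarrow> t' \<subseteq> insert v \<rho> \<longrightarrow> t' \<subseteq> \<rho> \<or> (\<exists>t''\<in>T. t'' \<subseteq> \<rho> \<and> key s < key t'')))"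
      using Suc.prems(3) by meson
    \<comment> \<open>The strict inequality of keys excludes the minimal \<open>t\<close>, so the
      last alternative of the hypothesis survives the passage to \<open>T - {t}\<close>.\<close>
    have "t'' \<in> ?T" if "t'' \<in> T" "key s < key t''" for t''
      using that tmin[OF \<open>s \<in> T\<close>] by auto
    then have "(\<exists>t''\<in>T. t'' \<subseteq> \<rho> \<and> key s < key t'') = (\<exists>t''\<in>?T. t'' \<subseteq> \<rho> \<and> key s < key t'')" for \<rho>
      by auto
    then show ?thesis
      using v by (intro exI[of _ v]) simp
  qed
  ultimately have "top_of_set (polyhedron K) homotopy_equivalent_space top_of_set (polyhedron ?K)"
    using Suc.prems by (intro Suc.hyps(1)) auto
  also have "top_of_set (polyhedron ?K) homotopy_equivalent_space
      top_of_set (polyhedron {\<rho> \<in> ?K. \<not> t \<subseteq> \<rho>})"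
  proof -
    obtain v where v: "v \<notin> t" "\<forall>\<rho>\<in>K. t \<subseteq> \<rho> \<longrightarrow> insert v \<rho> \<in> K \<and>
       (\<forall>t'\<in>T. key t \<le> key t' \<longrightarrow> t' \<subseteq> insert v \<rho> \<longrightarrow> t' \<subseteq> \<rho> \<or> (\<exists>t''\<in>T. t'' \<subseteq> \<rho> \<and> key t < key t''))"
      using Suc.prems(3) t(1) by meson
    have ins: "insert v \<rho> \<in> ?K" if \<rho>: "\<rho> \<in> ?K" "t \<subseteq> \<rho>" for \<rho>
    proof -
      have "\<not> t' \<subseteq> insert v \<rho>" if t': "t' \<in> ?T" for t'
      proof
        assume "t' \<subseteq> insert v \<rho>"
        then have "t' \<subseteq> \<rho> \<or> (\<exists>t''\<in>T. t'' \<subseteq> \<rho> \<and> key t < key t'')"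
          using v(2)[rule_format, of \<rho>, THEN conjunct2, rule_format, of t'] \<rho> t' tmin by simp
        then obtain t'' where "t'' \<in> ?T" "t'' \<subseteq> \<rho>"
          using t' by auto
        then show False
          using \<rho>(1) by blast
      qed
      then show ?thesis
        using v(2)[rule_format, of \<rho>, THEN conjunct1] \<rho> by simp
    qed
    have "finite t" "t \<noteq> {}"
      using Suc.prems(2)[OF t(1)] by simp_all
    then show ?thesis
      by (rule homotopy_equivalent_collapse[OF finite_complex_avoiding[OF K] _ _ v(1) ins])
  qed
  also have "{\<rho> \<in> ?K. \<not> t \<subseteq> \<rho>} = {\<rho> \<in> K. \<forall>t\<in>T. \<not> t \<subseteq> \<rho>}"
    using t(1) by auto
  finally show ?case .
qed

section \<open>Extending homotopies and shrinking contractible subcomplexes\<close>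

text \<open>A point of \<open>\<sigma>\<close> is \<open>(1 - r) c + r b\<close> with \<open>c\<close> the barycenter and \<open>b\<close> on the boundary. At time \<open>t\<close> the radius
  is stretched to \<open>r (1 + t)\<close>, and any excess over 1 is used as the time of the homotopy on the boundary.\<close>

lemma homotopy_extension_simplex:
  fixes K :: "'a set set"
  assumes K: "finite_complex K" and K': "finite_complex (insert \<sigma> K)" and "\<sigma> \<notin> K"
    and H: "continuous_on ({0..1} \<times> polyhedron K) H"
      "H ` ({0..1} \<times> polyhedron K) \<subseteq> polyhedron (insert \<sigma> K)"
      "\<And>p. p \<in> polyhedron K \<Longrightarrow> H (0, p) = p"
  shows "\<exists>H'. continuous_on ({0..1::real} \<times> polyhedron (insert \<sigma> K)) H' \<and>
      H' ` ({0..1} \<times> polyhedron (insert \<sigma> K)) \<subseteq> polyhedron (insert \<sigma> K) \<and>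
      (\<forall>p\<in>polyhedron (insert \<sigma> K). H' (0, p) = p) \<and>
      (\<forall>t\<in>{0..1}. \<forall>p\<in>polyhedron K. H' (t, p) = H (t, p))"
proof -
  let ?P = "polyhedron (insert \<sigma> K)"
  have \<sigma>: "finite \<sigma>" "\<sigma> \<noteq> {}"
    using K' unfolding finite_complex_def by auto
  define k where "k = real (card \<sigma>)"
  have k: "k > 0"
    unfolding k_def using \<sigma> by (simp add: card_gt_0_iff)
  define c where "c = (\<lambda>x. if x \<in> \<sigma> then 1 / k else 0)"
  define \<mu> where "\<mu> = (\<lambda>p :: 'a \<Rightarrow> real. Min (p ` \<sigma>))"
  \<comment> \<open>On \<open>polyhedron K\<close> the minimum vanishes, so \<open>r p = 1\<close>
    and \<open>b p = p\<close>, and \<open>G\<close> reduces to \<open>H\<close> there. One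
    definition therefore serves on all simplices.\<close>
  define r where "r = (\<lambda>p. 1 - k * \<mu> p)"
  define b where "b = (\<lambda>p x. (p x - k * \<mu> p * c x) / r p)"
  define GA where "GA = (\<lambda>(t, p) x. (1 + t) * (p x - k * \<mu> p * c x) + (1 - r p * (1 + t)) * c x)"
  define GB where "GB = (\<lambda>(t, p). H (r p * (1 + t) - 1, b p))"
  define G where "G = (\<lambda>z. if r (snd z) * (1 + fst z) \<le> 1 then GA z else GB z)"
  have cont\<mu>: "continuous_on S (\<lambda>z. \<mu> (snd z))" for S :: "(real \<times> ('a \<Rightarrow> real)) set"
    unfolding \<mu>_def
    by (rule continuous_on_compose2[OF continuous_on_Min_coordinates[OF \<sigma>, of UNIV]])
      (auto intro: continuous_intros)
  have contp: "continuous_on S (\<lambda>z. snd z x)" for S :: "(real \<times> ('a \<Rightarrow> real)) set" and x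
    by (rule continuous_on_compose2[OF continuous_on_coordinate[of UNIV]]) (auto intro: continuous_intros)
  have contr: "continuous_on S (\<lambda>z. r (snd z))" for S :: "(real \<times> ('a \<Rightarrow> real)) set"
    unfolding r_def by (intro continuous_intros cont\<mu>)
  have sumc: "sum c \<sigma> = 1"
    unfolding c_def k_def using \<sigma> by simp
  have \<mu>0: "\<mu> p = 0" if p: "\<And>x. 0 \<le> p x" and "\<not> \<sigma> \<subseteq> {x. p x \<noteq> 0}" for p
  proof -
    have "0 \<in> p ` \<sigma>"
      using that(2) by force
    then show ?thesis
      unfolding \<mu>_def using \<sigma> p by (intro Min_eqI) auto
  qed
  have \<mu>_le: "\<mu> p \<le> p x" if "x \<in> \<sigma>" for p x
    unfolding \<mu>_def using \<sigma> that by simp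
  have \<mu>_ge: "0 \<le> \<mu> p" if "p \<in> ?P" for p
    unfolding \<mu>_def using \<sigma> that by (subst Min_ge_iff) (auto simp: polyhedron_iff[OF K'])
  have shift_nonneg: "0 \<le> p x - k * \<mu> p * c x" if "p \<in> ?P" for p x
    using \<mu>_le[of x p] that k by (auto simp: c_def polyhedron_iff[OF K'])
  \<comment> \<open>Since \<open>\<sigma> \<notin> K\<close> and \<open>K\<close> is closed under
    faces, a support containing \<open>\<sigma>\<close> is \<open>\<sigma>\<close> itself.\<close>
  have cases: "\<mu> p = 0 \<and> p \<in> polyhedron K \<or>
      (\<forall>x. x \<notin> \<sigma> \<longrightarrow> p x = 0) \<and> sum p \<sigma> = 1" if "p \<in> ?P" for p
  proof (cases "\<sigma> \<subseteq> {x. p x \<noteq> 0}")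
    case True
    then have "{x. p x \<noteq> 0} = \<sigma>"
      using that \<sigma> \<open>\<sigma> \<notin> K\<close> finite_complex_face[OF K _ True] by (auto simp: polyhedron_iff[OF K'])
    then show ?thesis
      using that by (auto simp: polyhedron_iff[OF K'])
  next
    case False
    then show ?thesis
      using that \<mu>0[of p] by (auto simp: polyhedron_iff[OF K'] polyhedron_iff[OF K])
  qed
  have b: "b p \<in> polyhedron K" if "p \<in> ?P" "r p > 0" for p
  proof (cases "\<mu> p = 0 \<and> p \<in> polyhedron K")
    case True
    then have "b p = p"
      unfolding b_def r_def by auto
    with True show ?thesis
      by simp
  next
    case False
    then have p: "\<And>x. x \<notin> \<sigma> \<Longrightarrow> p x = 0" "sum p \<sigma> = 1"
      using cases[OF that(1)] by auto
    have nonneg: "0 \<le> b p x" for x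
      unfolding b_def using shift_nonneg[OF that(1), of x] that(2) by simp
    have out: "b p x = 0" if "x \<notin> \<sigma>" for x
      unfolding b_def c_def using p that by simp
    have "sum (b p) \<sigma> = (sum p \<sigma> - k * \<mu> p * sum c \<sigma>) / r p"
      unfolding b_def by (simp add: sum_divide_distrib[symmetric] sum_subtractf sum_distrib_left)
    then have sum1: "sum (b p) \<sigma> = 1"
      using p sumc that(2) unfolding r_def by simp
    have mem: "b p \<in> ?P"
      using nonneg out sum1 by (intro polyhedronI[of \<sigma>]) auto
    have "\<mu> p \<in> p ` \<sigma>"
      unfolding \<mu>_def using \<sigma> by simp
    then obtain x where "x \<in> \<sigma>" "p x = \<mu> p"
      by auto
    then have "b p x = 0"
      unfolding b_def c_def using k by simp
    then have "{x. b p x \<noteq> 0} \<noteq> \<sigma>"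
      using \<open>x \<in> \<sigma>\<close> by blast
    then show ?thesis
      using mem by (auto simp: polyhedron_iff[OF K'] polyhedron_iff[OF K])
  qed
  have r_le: "r p \<le> 1" if "p \<in> ?P" for p
    unfolding r_def using k \<mu>_ge[OF that] by simp
  have GB_dom: "r p > 0 \<and> r p * (1 + t) - 1 \<in> {0..1} \<and> b p \<in> polyhedron K"
    if "p \<in> ?P" "t \<in> {0..1}" "1 \<le> r p * (1 + t)" for t p
  proof -
    have "r p > 0"
      using that by (smt (verit) atLeastAtMost_iff mult_nonpos_nonneg)
    moreover have "r p * (1 + t) \<le> 1 * 2"
      using that r_le[OF that(1)] \<open>r p > 0\<close> by (intro mult_mono) auto
    ultimately show ?thesis
      using that b by auto
  qed
  have contG: "continuous_on ({0..1} \<times> ?P) G"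
    unfolding G_def
  proof (rule continuous_on_cases_le)
    show "continuous_on {z \<in> {0..1} \<times> ?P. r (snd z) * (1 + fst z) \<le> 1} GA"
      unfolding GA_def case_prod_unfold
      by (intro continuous_on_coordinatewise_then_product continuous_intros cont\<mu> contp contr)
    show "continuous_on {z \<in> {0..1} \<times> ?P. 1 \<le> r (snd z) * (1 + fst z)} GB"
      unfolding GB_def case_prod_unfold
    proof (rule continuous_on_compose2[OF H(1)])
      have "continuous_on {z \<in> {0..1} \<times> ?P. 1 \<le> r (snd z) * (1 + fst z)} (\<lambda>z. b (snd z))"
        unfolding b_def
        by (intro continuous_on_coordinatewise_then_product continuous_intros cont\<mu> contp contr)
          (use GB_dom in fastforce)
      then show "continuous_on {z \<in> {0..1} \<times> ?P. 1 \<le> r (snd z) * (1 + fst z)}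
          (\<lambda>z. (r (snd z) * (1 + fst z) - 1, b (snd z)))"
        by (intro continuous_on_Pair continuous_on_diff continuous_on_mult continuous_on_add
            continuous_on_const continuous_on_fst continuous_on_id contr)
    qed (use GB_dom in fastforce)
    show "continuous_on ({0..1} \<times> ?P) (\<lambda>z. r (snd z) * (1 + fst z))"
      by (intro continuous_intros contr)
    fix z
    assume z: "z \<in> {0..1} \<times> ?P" and eq: "r (snd z) * (1 + fst z) = 1"
    obtain t p where tp: "z = (t, p)"
      by force
    \<comment> \<open>On the seam the multiple of \<open>c\<close> in \<open>GA\<close> vanishes and
      \<open>1 + t = 1 / r p\<close>, so both branches give \<open>b p = H (0, b p)\<close>.\<close>
    have "r p > 0" "b p \<in> polyhedron K"
      using GB_dom[of p t] z eq unfolding tp by auto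
    moreover have "1 + t = 1 / r p"
      using eq \<open>r p > 0\<close> unfolding tp by (simp add: field_simps)
    ultimately show "GA z = GB z"
      using H(3) eq unfolding tp GA_def GB_def b_def by auto
  qed
  have GA_mem: "GA (t, p) \<in> ?P" if "p \<in> ?P" "t \<in> {0..1}" "r p * (1 + t) \<le> 1" for t p
  proof (cases "\<mu> p = 0 \<and> p \<in> polyhedron K")
    case True
    then have "t = 0"
      using that unfolding r_def by simp
    then have "GA (t, p) = p"
      using True unfolding GA_def r_def by auto
    then show ?thesis
      using that by simp
  next
    case False
    then have p: "\<And>x. x \<notin> \<sigma> \<Longrightarrow> p x = 0" "sum p \<sigma> = 1"
      using cases[OF that(1)] by auto
    have nonneg: "0 \<le> GA (t, p) x" for x
      using shift_nonneg[OF that(1), of x] that k unfolding GA_def by (auto simp: c_def)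
    have out: "GA (t, p) x = 0" if "x \<notin> \<sigma>" for x
      unfolding GA_def c_def using p that by simp
    have "sum (GA (t, p)) \<sigma> =
        (1 + t) * (sum p \<sigma> - k * \<mu> p * sum c \<sigma>) + (1 - r p * (1 + t)) * sum c \<sigma>"
      unfolding GA_def by (simp add: sum.distrib sum_subtractf flip: sum_distrib_left)
    then have "sum (GA (t, p)) \<sigma> = 1"
      using p sumc unfolding r_def by (simp add: algebra_simps)
    then show ?thesis
      using nonneg out by (intro polyhedronI[of \<sigma>]) auto
  qed
  have G_mem: "G (t, p) \<in> ?P" if "p \<in> ?P" "t \<in> {0..1}" for t p
  proof (cases "r p * (1 + t) \<le> 1")
    case True
    then show ?thesis
      unfolding G_def using GA_mem[OF that] by simp
  next
    case False
    then show ?thesis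
      unfolding G_def GB_def using GB_dom[OF that] H(2) by auto
  qed
  have G0: "G (0, p) = p" if "p \<in> ?P" for p
    unfolding G_def GA_def using r_le[OF that] by (auto simp: r_def algebra_simps)
  have sub: "polyhedron K \<subseteq> ?P"
    unfolding polyhedron_def by auto
  have G_ext: "G (t, p) = H (t, p)" if "p \<in> polyhedron K" "t \<in> {0..1}" for t p
  proof (cases "t = 0")
    case True
    then show ?thesis
      using G0 H(3) that sub by auto
  next
    case False
    have "\<not> \<sigma> \<subseteq> {x. p x \<noteq> 0}"
      using that(1) \<sigma>(2) \<open>\<sigma> \<notin> K\<close> finite_complex_face[OF K, of _ \<sigma>] by (auto simp: polyhedron_iff[OF K])
    then have "\<mu> p = 0"
      using \<mu>0[of p] that(1) by (auto simp: polyhedron_iff[OF K])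
    then have "r p = 1" "b p = p"
      unfolding r_def b_def by auto
    then show ?thesis
      using False that(2) unfolding G_def GB_def by auto
  qed
  show ?thesis
    using contG G_mem G0 G_ext by (intro exI[of _ G]) auto
qed

text \<open>Iterates the extension over a single simplex. The hypothesis on all
  \<open>S \<subseteq> T\<close> makes every order of attachment admissible; it holds when all
  proper faces of members of \<open>T\<close> lie in \<open>Z\<close>.\<close>

lemma homotopy_extension:
  fixes Z :: "'a set set"
  assumes Z: "finite_complex Z" and "finite T"
    and T: "\<And>S. S \<subseteq> T \<Longrightarrow> finite_complex (Z \<union> S)" and "Z \<inter> T = {}"
    and H: "continuous_on ({0..1} \<times> polyhedron Z) H"
      "H ` ({0..1} \<times> polyhedron Z) \<subseteq> polyhedron Z"
      "\<And>p. p \<in> polyhedron Z \<Longrightarrow> H (0, p) = p"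
  shows "\<exists>H'. continuous_on ({0..1::real} \<times> polyhedron (Z \<union> T)) H' \<and>
      H' ` ({0..1} \<times> polyhedron (Z \<union> T)) \<subseteq> polyhedron (Z \<union> T) \<and>
      (\<forall>p\<in>polyhedron (Z \<union> T). H' (0, p) = p) \<and>
      (\<forall>t\<in>{0..1}. \<forall>p\<in>polyhedron Z. H' (t, p) = H (t, p))"
  using \<open>finite T\<close> T \<open>Z \<inter> T = {}\<close>
proof (induction T rule: finite_induct)
  case empty
  then show ?case
    using H by auto
next
  case (insert \<sigma> T)
  let ?K = "Z \<union> T"
  have K: "finite_complex ?K" "finite_complex (Z \<union> insert \<sigma> T)"
    using insert.prems(1)[of T] insert.prems(1)[of "insert \<sigma> T"] by auto
  have sub: "finite_complex (Z \<union> S)" if "S \<subseteq> T" for S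
    using insert.prems(1)[of S] that by auto
  have disj: "Z \<inter> T = {}"
    using insert.prems(2) by auto
  obtain H1 where H1: "continuous_on ({0..1::real} \<times> polyhedron ?K) H1"
      "H1 ` ({0..1} \<times> polyhedron ?K) \<subseteq> polyhedron ?K"
      "\<forall>p\<in>polyhedron ?K. H1 (0, p) = p"
      "\<forall>t\<in>{0..1}. \<forall>p\<in>polyhedron Z. H1 (t, p) = H (t, p)"
    by (rule exE[OF insert.IH[OF _ disj]]) (use sub in \<open>blast+\<close>)
  have "\<sigma> \<notin> ?K"
    using insert by auto
  moreover have "H1 ` ({0..1} \<times> polyhedron ?K) \<subseteq> polyhedron (insert \<sigma> ?K)"
    by (rule order_trans[OF H1(2) polyhedron_mono]) auto
  ultimately obtain H2 where H2: "continuous_on ({0..1::real} \<times> polyhedron (insert \<sigma> ?K)) H2"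
      "H2 ` ({0..1} \<times> polyhedron (insert \<sigma> ?K)) \<subseteq> polyhedron (insert \<sigma> ?K)"
      "\<forall>p\<in>polyhedron (insert \<sigma> ?K). H2 (0, p) = p"
      "\<forall>t\<in>{0..1}. \<forall>p\<in>polyhedron ?K. H2 (t, p) = H1 (t, p)"
    using homotopy_extension_simplex[OF K(1), of \<sigma> H1] K(2) H1 by auto
  have "polyhedron Z \<subseteq> polyhedron ?K"
    unfolding polyhedron_def by auto
  then have "\<forall>t\<in>{0..1}. \<forall>p\<in>polyhedron Z. H2 (t, p) = H (t, p)"
    using H1(4) H2(4) by (metis subsetD)
  then show ?case
    using H2 by (intro exI[of _ H2]) auto
qed

section \<open>Shrinking a subset along a homotopy\<close>

text \<open>The end map of \<open>h\<close> is constant on \<open>Z\<close>, so it factors through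
  \<open>f\<close> and yields the homotopy inverse \<open>g\<close>. The homotopy \<open>h\<close>
  itself connects \<open>g \<circ> f\<close> to the identity, and its descent \<open>k\<close> to
  \<open>W\<close> does the same for \<open>f \<circ> g\<close>.\<close>

lemma homotopy_equivalent_quotient:
  assumes q: "quotient_map X W f"
    and fib: "\<And>x y. x \<in> topspace X \<Longrightarrow> y \<in> topspace X \<Longrightarrow> f x = f y \<longleftrightarrow> x = y \<or> x \<in> Z \<and> y \<in> Z"
    and h: "continuous_map (prod_topology (top_of_set {0..1::real}) X) X h"
    and h0: "\<And>x. x \<in> topspace X \<Longrightarrow> h (0, x) = x"
    and hZ: "\<And>t z. t \<in> {0..1} \<Longrightarrow> z \<in> topspace X \<Longrightarrow> z \<in> Z \<Longrightarrow> h (t, z) \<in> Z"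
    and h1: "\<And>z. z \<in> topspace X \<Longrightarrow> z \<in> Z \<Longrightarrow> h (1, z) = a"
  shows "X homotopy_equivalent_space W"
proof -
  let ?I = "top_of_set {0..1::real}"
  have f: "continuous_map X W f" "f ` topspace X = topspace W"
    using q by (auto simp: quotient_imp_continuous_map quotient_imp_surjective_map)
  have "continuous_map X X (\<lambda>x. h (1, x))"
    using continuous_map_o_Pair[OF h, of 1] by (simp add: o_def)
  then obtain g where g: "continuous_map W X g" "\<And>x. x \<in> topspace X \<Longrightarrow> g (f x) = h (1, x)"
    using quotient_map_lift_exists[OF q, of X "\<lambda>x. h (1, x)"] fib h1 by metis
  have "locally_compact_space ?I"
    by (simp add: compact_imp_locally_compact_space compact_space_subtopology)
  then have qI: "quotient_map (prod_topology ?I X) (prod_topology ?I W) (\<lambda>(t, x). (t, f x))"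
    using q by (intro quotient_map_prod_right) (auto simp: Hausdorff_space_subtopology)
  have mem: "h (t, x) \<in> topspace X" if "t \<in> {0..1}" "x \<in> topspace X" for t x
    using continuous_map_funspace[OF h] that by (auto simp: Pi_iff)
  obtain k where k: "continuous_map (prod_topology ?I W) W k"
      "\<And>z. z \<in> topspace (prod_topology ?I X) \<Longrightarrow> k ((\<lambda>(t, x). (t, f x)) z) = (f \<circ> h) z"
  proof (rule quotient_map_lift_exists[OF qI, of W "f \<circ> h"])
    show "continuous_map (prod_topology ?I X) W (f \<circ> h)"
      using h f(1) by (rule continuous_map_compose)
    show "(f \<circ> h) z = (f \<circ> h) z'"
      if "z \<in> topspace (prod_topology ?I X)" "z' \<in> topspace (prod_topology ?I X)"
        "(\<lambda>(t, x). (t, f x)) z = (\<lambda>(t, x). (t, f x)) z'" for z z'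
    proof -
      have "\<exists>t x y. z = (t, x) \<and> z' = (t, y) \<and> f x = f y"
        using that(3) by (cases z; cases z') auto
      then obtain t x y where z: "z = (t, x)" "z' = (t, y)" "f x = f y"
        by blast
      show ?thesis
        \<comment> \<open>Different points with the same image both lie in \<open>Z\<close>, where
          \<open>h\<close> keeps them at every time, so \<open>f\<close> still identifies
          them.\<close>
        using that(1,2) z(3) fib[of x y] hZ[of t x] hZ[of t y] mem[of t x] mem[of t y]
          fib[of "h (t, x)" "h (t, y)"] unfolding z by auto
    qed
  qed blast
  have k': "k (t, f x) = f (h (t, x))" if "t \<in> {0..1}" "x \<in> topspace X" for t x
    using k(2)[of "(t, x)"] that by simp
  have "homotopic_with (\<lambda>x. True) X X (g \<circ> f) id"
    by (subst homotopic_with_sym, subst homotopic_with) (use h h0 g in \<open>auto intro!: exI[of _ h]\<close>)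
  moreover have "homotopic_with (\<lambda>x. True) W W (f \<circ> g) id"
  proof -
    have "k (0, w) = w \<and> k (1, w) = f (g w)" if "w \<in> topspace W" for w
    proof -
      have "w \<in> f ` topspace X"
        using that f(2) by simp
      then obtain x where "x \<in> topspace X" "w = f x"
        by blast
      then show ?thesis
        using k'[of 0 x] k'[of 1 x] h0 g(2) by simp
    qed
    then show ?thesis
      by (subst homotopic_with_sym, subst homotopic_with) (use k(1) in \<open>auto intro!: exI[of _ k]\<close>)
  qed
  ultimately show ?thesis
    unfolding homotopy_equivalent_space_def using f(1) g(1) by blast
qed

text \<open>The radial map onto the plane \<open>p \<mapsto> ((p x - 1/3) / \<mu>, (p y - 1/3) / \<mu>)\<close>, where \<open>\<mu>\<close> is the least
  barycentric coordinate, followed by the inverse stereographic projection from \<^term>\<open>nsphere_base\<close>.\<close>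

definition triangle_to_sphere :: "'a \<Rightarrow> 'a \<Rightarrow> 'a \<Rightarrow> ('a \<Rightarrow> real) \<Rightarrow> nat \<Rightarrow> real" where
  "triangle_to_sphere x y z p =
     (let u = p x - 1/3; v = p y - 1/3; \<mu> = min (p x) (min (p y) (p z)); d = u\<^sup>2 + v\<^sup>2 + \<mu>\<^sup>2
      in (\<lambda>i. if i = 0 then (u\<^sup>2 + v\<^sup>2 - \<mu>\<^sup>2) / d else if i = 1 then 2 * \<mu> * u / d
              else if i = 2 then 2 * \<mu> * v / d else 0))"

text \<open>Applied with \<open>k = 1/3\<close> and three slopes of sum 0: it expresses the least
  barycentric coordinate through the planar coordinates and the scale \<open>\<mu>\<close>.\<close>

lemma min3_affine:
  fixes s t r k \<mu> :: real
  assumes "0 \<le> \<mu>"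
  shows "min (k + \<mu> * s) (min (k + \<mu> * t) (k + \<mu> * r)) = k + \<mu> * min s (min t r)"
  using assms by (simp add: min_add_distrib_right min_mult_distrib_left)

lemma nsphere_2: "nsphere 2 = top_of_set {w. (w 0)\<^sup>2 + (w 1)\<^sup>2 + (w 2)\<^sup>2 = 1 \<and> (\<forall>i>2. w i = 0)}"
  unfolding nsphere by (simp add: euclidean_product_topology numeral_2_eq_2)

lemma Hausdorff_nsphere: "Hausdorff_space (nsphere n)"
  unfolding nsphere by (intro Hausdorff_space_subtopology) (simp add: Hausdorff_space_product_topology)

context
  fixes x y z :: 'a
  assumes distinct: "x \<noteq> y" "x \<noteq> z" "y \<noteq> z"
begin

lemma triangle_coordinates:
  assumes "p \<in> closed_simplex {x, y, z}"
  shows "0 \<le> p x" "0 \<le> p y" "0 \<le> p z" "p z = 1 - p x - p y" "\<And>v. v \<notin> {x, y, z} \<Longrightarrow> p v = 0"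
  using assms distinct unfolding closed_simplex_def by auto

lemma triangle_to_sphere_denominator:
  assumes "p \<in> closed_simplex {x, y, z}"
  shows "(p x - 1/3)\<^sup>2 + (p y - 1/3)\<^sup>2 + (min (p x) (min (p y) (p z)))\<^sup>2 > 0"
proof (cases "p x = 1/3 \<and> p y = 1/3")
  case True
  then have eq: "p x = 1/3" "p y = 1/3" "p z = 1/3"
    using triangle_coordinates(4)[OF assms] by auto
  show ?thesis
    unfolding eq by simp
next
  case False
  then have "(p x - 1/3)\<^sup>2 + (p y - 1/3)\<^sup>2 > 0"
    by (simp add: sum_power2_gt_zero_iff)
  then show ?thesis
    by (simp add: add_pos_nonneg)
qed

lemma continuous_on_triangle_to_sphere:
  "continuous_on (closed_simplex {x, y, z}) (triangle_to_sphere x y z)"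
proof (rule continuous_on_coordinatewise_then_product)
  fix i :: nat
  have d: "(p x - 1/3)\<^sup>2 + (p y - 1/3)\<^sup>2 + (min (p x) (min (p y) (p z)))\<^sup>2 \<noteq> 0"
    if "p \<in> closed_simplex {x, y, z}" for p
    using triangle_to_sphere_denominator[OF that] by simp
  have c: "continuous_on (closed_simplex {x, y, z}) (\<lambda>p. p v)" for v
    by (rule continuous_on_coordinate)
  consider "i = 0" | "i = 1" | "i = 2" | "i \<noteq> 0" "i \<noteq> 1" "i \<noteq> 2"
    by blast
  then show "continuous_on (closed_simplex {x, y, z}) (\<lambda>p. triangle_to_sphere x y z p i)"
    by cases (simp_all add: triangle_to_sphere_def Let_def d c continuous_on_divide continuous_on_add
        continuous_on_diff continuous_on_mult continuous_on_power continuous_on_min)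
qed

lemma triangle_to_sphere_in_sphere:
  assumes "p \<in> closed_simplex {x, y, z}"
  shows "triangle_to_sphere x y z p \<in> topspace (nsphere 2)"
proof -
  define u v \<mu> where "u = p x - 1/3" and "v = p y - 1/3" and "\<mu> = min (p x) (min (p y) (p z))"
  define d where "d = u\<^sup>2 + v\<^sup>2 + \<mu>\<^sup>2"
  have "d > 0"
    using triangle_to_sphere_denominator[OF assms] unfolding d_def u_def v_def \<mu>_def .
  have "(u\<^sup>2 + v\<^sup>2 - \<mu>\<^sup>2)\<^sup>2 + (2 * \<mu> * u)\<^sup>2 + (2 * \<mu> * v)\<^sup>2 = d\<^sup>2"
    unfolding d_def by algebra
  then have "((u\<^sup>2 + v\<^sup>2 - \<mu>\<^sup>2) / d)\<^sup>2 + (2 * \<mu> * u / d)\<^sup>2 + (2 * \<mu> * v / d)\<^sup>2 = 1"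
    using \<open>d > 0\<close> by (simp add: power_divide flip: add_divide_distrib)
  then show ?thesis
    unfolding nsphere_2 triangle_to_sphere_def Let_def u_def[symmetric] v_def[symmetric] \<mu>_def[symmetric]
      d_def[symmetric] by simp
qed

lemma triangle_to_sphere_0:
  assumes "p \<in> closed_simplex {x, y, z}"
  defines "\<mu> \<equiv> min (p x) (min (p y) (p z))"
  shows "triangle_to_sphere x y z p 0 = 1 \<longleftrightarrow> \<mu> = 0"
    and "1 - triangle_to_sphere x y z p 0 = 2 * \<mu>\<^sup>2 / ((p x - 1/3)\<^sup>2 + (p y - 1/3)\<^sup>2 + \<mu>\<^sup>2)"
proof -
  show eq: "1 - triangle_to_sphere x y z p 0 = 2 * \<mu>\<^sup>2 / ((p x - 1/3)\<^sup>2 + (p y - 1/3)\<^sup>2 + \<mu>\<^sup>2)"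
    using triangle_to_sphere_denominator[OF assms(1)]
    unfolding triangle_to_sphere_def Let_def \<mu>_def by (simp add: field_simps)
  show "triangle_to_sphere x y z p 0 = 1 \<longleftrightarrow> \<mu> = 0"
    using eq triangle_to_sphere_denominator[OF assms(1)] unfolding \<mu>_def by auto
qed

text \<open>The least coordinate vanishes exactly on the boundary. The boundary is sent to infinity
  in the plane, which is the projection centre \<open>nsphere_base\<close>.\<close>

lemma triangle_to_sphere_base_iff:
  assumes "p \<in> closed_simplex {x, y, z}"
  shows "triangle_to_sphere x y z p = nsphere_base \<longleftrightarrow> p x = 0 \<or> p y = 0 \<or> p z = 0"
proof -
  let ?\<mu> = "min (p x) (min (p y) (p z))"
  have "?\<mu> = 0 \<longleftrightarrow> p x = 0 \<or> p y = 0 \<or> p z = 0"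
    using triangle_coordinates(1-3)[OF assms] by (auto simp: min_def)
  moreover have "triangle_to_sphere x y z p = nsphere_base \<longleftrightarrow> ?\<mu> = 0"
  proof
    assume "triangle_to_sphere x y z p = nsphere_base"
    then show "?\<mu> = 0"
      using triangle_to_sphere_0(1)[OF assms] by (simp add: nsphere_base_def)
  next
    assume "?\<mu> = 0"
    then show "triangle_to_sphere x y z p = nsphere_base"
      using triangle_to_sphere_0(1)[OF assms]
      by (auto simp: fun_eq_iff nsphere_base_def) (auto simp: triangle_to_sphere_def Let_def)
  qed
  ultimately show ?thesis
    by simp
qed

text \<open>Stereographic projection recovers the planar point \<open>(s, t)\<close>. The scale is
  then forced: the coordinates are \<open>1/3\<close> plus \<open>\<mu>\<close> times
  \<open>s\<close>, \<open>t\<close>, \<open>- (s + t)\<close>, and their minimum must again be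
  \<open>\<mu>\<close>.\<close>

lemma triangle_to_sphere_inj:
  assumes p: "p \<in> closed_simplex {x, y, z}" and q: "q \<in> closed_simplex {x, y, z}"
    and eq: "triangle_to_sphere x y z p = triangle_to_sphere x y z q"
    and nb: "triangle_to_sphere x y z p \<noteq> nsphere_base"
  shows "p = q"
proof -
  define \<mu> where "\<mu> = (\<lambda>p. min (p x) (min (p y) (p z) :: real))"
  define s where "s = (\<lambda>p. (p x - 1/3) / \<mu> p)"
  define t where "t = (\<lambda>p. (p y - 1/3) / \<mu> p)"
  have *: "\<mu> p > 0 \<and> s p = triangle_to_sphere x y z p 1 / (1 - triangle_to_sphere x y z p 0) \<and>
      t p = triangle_to_sphere x y z p 2 / (1 - triangle_to_sphere x y z p 0) \<and>
      \<mu> p * (1 - min (s p) (min (t p) (- (s p + t p)))) = 1/3"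
    if p: "p \<in> closed_simplex {x, y, z}" and nb: "triangle_to_sphere x y z p \<noteq> nsphere_base" for p
  proof -
    have pos: "\<mu> p > 0"
      using nb triangle_coordinates(1-3)[OF p] unfolding triangle_to_sphere_base_iff[OF p] \<mu>_def by auto
    have d: "(p x - 1/3)\<^sup>2 + (p y - 1/3)\<^sup>2 + (\<mu> p)\<^sup>2 > 0"
      using triangle_to_sphere_denominator[OF p] unfolding \<mu>_def .
    have e: "1 - triangle_to_sphere x y z p 0 = 2 * (\<mu> p)\<^sup>2 / ((p x - 1/3)\<^sup>2 + (p y - 1/3)\<^sup>2 + (\<mu> p)\<^sup>2)"
      using triangle_to_sphere_0(2)[OF p] unfolding \<mu>_def .
    have f: "triangle_to_sphere x y z p 1 = 2 * \<mu> p * (p x - 1/3) / ((p x - 1/3)\<^sup>2 + (p y - 1/3)\<^sup>2 + (\<mu> p)\<^sup>2)"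
      "triangle_to_sphere x y z p 2 = 2 * \<mu> p * (p y - 1/3) / ((p x - 1/3)\<^sup>2 + (p y - 1/3)\<^sup>2 + (\<mu> p)\<^sup>2)"
      unfolding triangle_to_sphere_def Let_def \<mu>_def by simp_all
    have ms: "\<mu> p * s p = p x - 1/3" "\<mu> p * t p = p y - 1/3"
      using pos unfolding s_def t_def by simp_all
    have coords: "p x = 1/3 + \<mu> p * s p" "p y = 1/3 + \<mu> p * t p" "p z = 1/3 + \<mu> p * - (s p + t p)"
      using ms triangle_coordinates(4)[OF p] by (simp_all add: algebra_simps)
    have "\<mu> p = 1/3 + \<mu> p * min (s p) (min (t p) (- (s p + t p)))"
      using min3_affine[of "\<mu> p" "1/3" "s p" "t p" "- (s p + t p)"] pos
      unfolding coords[symmetric] by (simp add: \<mu>_def)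
    then have "\<mu> p * (1 - min (s p) (min (t p) (- (s p + t p)))) = 1/3"
      by (simp add: right_diff_distrib)
    moreover have "2 * \<mu> p * r / d / (2 * (\<mu> p)\<^sup>2 / d) = r / \<mu> p" if "d > 0" for r d
      using that pos by (simp add: power2_eq_square)
    ultimately show ?thesis
      using pos d unfolding e f by (simp add: s_def t_def)
  qed
  have st: "s p = s q" "t p = t q"
    using *[OF p nb] *[OF q] eq nb by auto
  \<comment> \<open>Both scales have the same product \<open>1/3\<close> with the same factor, which
    is therefore nonzero and can be cancelled.\<close>
  have "\<mu> p = \<mu> q"
    using *[OF p nb] *[OF q] eq nb st by (metis mult_right_cancel mult_zero_right zero_neq_one
        divide_eq_0_iff zero_neq_numeral)
  then have "p x = q x" "p y = q y"
    using st *[OF p nb] unfolding s_def t_def by auto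
  then show ?thesis
    using triangle_coordinates(4,5)[OF p] triangle_coordinates(4,5)[OF q] by (metis ext insertE singletonD)
qed

lemma triangle_to_sphere_surj:
  assumes w: "w \<in> topspace (nsphere 2)"
  shows "w \<in> triangle_to_sphere x y z ` closed_simplex {x, y, z}"
proof (cases "w 0 = 1")
  case True
  \<comment> \<open>Any boundary point is a preimage of the base point; the vertex \<open>x\<close>
    is one.\<close>
  define p where "p = (\<lambda>v. if v = x then 1 else 0 :: real)"
  have p: "p \<in> closed_simplex {x, y, z}"
    unfolding closed_simplex_def p_def using distinct by auto
  have "w i = nsphere_base i" for i
    using w True unfolding nsphere_2 nsphere_base_def
    by (cases "i > 2") (auto simp: less_Suc_eq not_less le_Suc_eq numeral_2_eq_2 add_nonneg_eq_0_iff)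
  then have "w = nsphere_base"
    by blast
  then show ?thesis
    using triangle_to_sphere_base_iff[OF p] distinct p by (metis image_eqI p_def)
next
  case False
  have w1: "(w 0)\<^sup>2 + (w 1)\<^sup>2 + (w 2)\<^sup>2 = 1" "\<And>i. i > 2 \<Longrightarrow> w i = 0"
    using w unfolding nsphere_2 by auto
  then have "(w 0)\<^sup>2 \<le> 1"
    by (metis add.assoc le_add_same_cancel1 sum_power2_ge_zero)
  then have lt: "w 0 < 1"
    using False by (simp add: power2_le_iff_abs_le abs_square_le_1)
  define s where "s = w 1 / (1 - w 0)"
  define t where "t = w 2 / (1 - w 0)"
  define m where "m = min s (min t (- (s + t)))"
  \<comment> \<open>Chosen so that the least coordinate \<open>1/3 + \<mu> * m\<close> equals
    \<open>\<mu>\<close>. Here \<open>m \<le> 0\<close>, since three numbers of sum 0 are not all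
    positive, so the denominator is positive.\<close>
  define \<mu> where "\<mu> = 1 / (3 * (1 - m))"
  have "m \<le> 0"
    unfolding m_def by (auto simp: min_def)
  then have \<mu>: "\<mu> > 0" "1/3 + \<mu> * m = \<mu>"
    unfolding \<mu>_def by (auto simp: field_simps)
  define p where "p = (\<lambda>v. if v = x then 1/3 + \<mu> * s else if v = y then 1/3 + \<mu> * t
     else if v = z then 1/3 + \<mu> * - (s + t) else 0)"
  have pv: "p x = 1/3 + \<mu> * s" "p y = 1/3 + \<mu> * t" "p z = 1/3 + \<mu> * - (s + t)"
    unfolding p_def using distinct by auto
  have min: "min (p x) (min (p y) (p z)) = \<mu>"
    unfolding pv using min3_affine[of \<mu> "1/3" s t "- (s + t)"] \<mu> unfolding m_def by simp
  have nn: "0 \<le> p x" "0 \<le> p y" "0 \<le> p z"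
    using min \<mu>(1) by (auto simp: min_def split: if_splits)
  have "p \<in> closed_simplex {x, y, z}"
    unfolding closed_simplex_def
  proof (intro CollectI conjI allI impI)
    show "0 \<le> p v" for v
      using nn by (cases "v \<in> {x, y, z}") (auto simp: p_def)
    show "p v = 0" if "v \<notin> {x, y, z}" for v
      using that unfolding p_def by auto
    show "sum p {x, y, z} = 1"
      using distinct pv by (simp add: algebra_simps)
  qed
  moreover have "triangle_to_sphere x y z p = w"
  proof
    fix i
    have d: "s\<^sup>2 + t\<^sup>2 + 1 = 2 / (1 - w 0)" "s\<^sup>2 + t\<^sup>2 - 1 = 2 * w 0 / (1 - w 0)"
    proof -
      have "s\<^sup>2 + t\<^sup>2 = ((w 1)\<^sup>2 + (w 2)\<^sup>2) / (1 - w 0)\<^sup>2"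
        unfolding s_def t_def by (simp add: power_divide add_divide_distrib)
      also have "(w 1)\<^sup>2 + (w 2)\<^sup>2 = (1 - w 0) * (1 + w 0)"
        using w1(1) by (simp add: power2_eq_square algebra_simps)
      also have "\<dots> / (1 - w 0)\<^sup>2 = (1 + w 0) / (1 - w 0)"
        using lt by (simp add: power2_eq_square)
      finally have st: "s\<^sup>2 + t\<^sup>2 = (1 + w 0) / (1 - w 0)" .
      show "s\<^sup>2 + t\<^sup>2 + 1 = 2 / (1 - w 0)" "s\<^sup>2 + t\<^sup>2 - 1 = 2 * w 0 / (1 - w 0)"
        unfolding st using lt by (simp_all add: field_simps)
    qed
    have scale: "(\<mu> * s)\<^sup>2 + (\<mu> * t)\<^sup>2 + \<mu>\<^sup>2 = \<mu>\<^sup>2 * (s\<^sup>2 + t\<^sup>2 + 1)"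
      "(\<mu> * s)\<^sup>2 + (\<mu> * t)\<^sup>2 - \<mu>\<^sup>2 = \<mu>\<^sup>2 * (s\<^sup>2 + t\<^sup>2 - 1)"
      by (simp_all add: power_mult_distrib algebra_simps)
    have "triangle_to_sphere x y z p i = (if i = 0 then ((\<mu> * s)\<^sup>2 + (\<mu> * t)\<^sup>2 - \<mu>\<^sup>2) / ((\<mu> * s)\<^sup>2 + (\<mu> * t)\<^sup>2 + \<mu>\<^sup>2)
       else if i = 1 then 2 * \<mu> * (\<mu> * s) / ((\<mu> * s)\<^sup>2 + (\<mu> * t)\<^sup>2 + \<mu>\<^sup>2)
       else if i = 2 then 2 * \<mu> * (\<mu> * t) / ((\<mu> * s)\<^sup>2 + (\<mu> * t)\<^sup>2 + \<mu>\<^sup>2) else 0)"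
      unfolding triangle_to_sphere_def Let_def min by (simp add: pv(1,2))
    also have "\<dots> = w i"
      unfolding scale d using \<mu>(1) lt w1(2)[of i]
      by (auto simp: s_def t_def power2_eq_square not_less le_Suc_eq numeral_2_eq_2)
    finally show "triangle_to_sphere x y z p i = w i" .
  qed
  ultimately show ?thesis
    by blast
qed

lemma quotient_map_triangle_to_sphere:
  "quotient_map (top_of_set (closed_simplex {x, y, z})) (nsphere 2) (triangle_to_sphere x y z)"
proof (rule T1_Spaces.continuous_imp_quotient_map)
  show "continuous_map (top_of_set (closed_simplex {x, y, z})) (nsphere 2) (triangle_to_sphere x y z)"
    using continuous_on_triangle_to_sphere triangle_to_sphere_in_sphere
    unfolding nsphere_2 by (auto simp: continuous_map_in_subtopology)
  show "compact_space (top_of_set (closed_simplex {x, y, z}))"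
    by (simp add: compact_closed_simplex compact_space_subtopology)
  show "Hausdorff_space (nsphere 2)"
    by (rule Hausdorff_nsphere)
  show "triangle_to_sphere x y z ` topspace (top_of_set (closed_simplex {x, y, z})) = topspace (nsphere 2)"
    using triangle_to_sphere_in_sphere triangle_to_sphere_surj by auto
qed

end

section \<open>Attaching triangles to a contractible complex\<close>

lemma topspace_wedge_sum:
  "topspace (wedge_sum X p I) = insert None (wedge_map p ` topspace (sum_topology X I))" (is "_ = ?A")
proof
  show "topspace (wedge_sum X p I) \<subseteq> ?A"
    using openin_wedge_sum[of X p I "topspace (wedge_sum X p I)"] by simp
  have "{z \<in> topspace (sum_topology X I). wedge_map p z \<in> ?A} = topspace (sum_topology X I)"
    by auto
  then have "openin (wedge_sum X p I) ?A"
    unfolding openin_wedge_sum by (metis openin_topspace subset_refl)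
  then show "?A \<subseteq> topspace (wedge_sum X p I)"
    by (rule openin_subset)
qed

text \<open>The boundaries of the triangles in \<open>T\<close> lie in \<open>Z\<close>, so
  shrinking \<open>Z\<close> to a point turns each triangle into a sphere. The shrinking is an
  equivalence because a contraction of \<open>Z\<close> extends to a homotopy of the whole
  polyhedron.\<close>

lemma homotopy_equivalent_wedge_of_spheres:
  fixes Z :: "'a set set"
  assumes Z: "finite_complex Z" "Z \<noteq> {}" and contr: "contractible_space (top_of_set (polyhedron Z))"
    and T: "finite T" "\<And>t. t \<in> T \<Longrightarrow> card t = 3" "Z \<inter> T = {}"
    and faces: "\<And>t \<rho>. t \<in> T \<Longrightarrow> \<rho> \<subset> t \<Longrightarrow> \<rho> \<noteq> {} \<Longrightarrow> \<rho> \<in> Z"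
  shows "top_of_set (polyhedron (Z \<union> T)) homotopy_equivalent_space wedge_of_spheres (card T) 2"
proof -
  define N where "N = card T"
  define P where "P = polyhedron (Z \<union> T)"
  have cpx: "finite_complex (Z \<union> S)" if "S \<subseteq> T" for S
  proof -
    have 1: "finite \<sigma> \<and> \<sigma> \<noteq> {}" if "\<sigma> \<in> Z \<union> S" for \<sigma>
    proof (cases "\<sigma> \<in> Z")
      case True
      then show ?thesis
        using Z(1) unfolding finite_complex_def by simp
    next
      case False
      then have "card \<sigma> = 3"
        using that \<open>S \<subseteq> T\<close> T(2) by blast
      then show ?thesis
        by (metis card.empty card.infinite zero_neq_numeral)
    qed
    have 2: "\<rho> \<in> Z \<union> S" if "\<sigma> \<in> Z \<union> S" "\<rho> \<subseteq> \<sigma>" "\<rho> \<noteq> {}" for \<sigma> \<rho>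
      using that faces[of \<sigma> \<rho>] \<open>S \<subseteq> T\<close> finite_complex_face[OF Z(1), of \<sigma> \<rho>] by auto
    have "finite (Z \<union> S)"
      using finite_complex_finite[OF Z(1)] finite_subset[OF that T(1)] by simp
    then show ?thesis
      unfolding finite_complex_def using 1 2 by simp
  qed
  obtain e where e: "bij_betw e {..<N} T"
    using ex_bij_betw_nat_finite[OF T(1)] unfolding N_def atLeast0LessThan by blast
  have eT: "e i \<in> T" if "i < N" for i
    using e that by (auto simp: bij_betw_def)
  have "\<forall>i. \<exists>v. i < N \<longrightarrow> (case v of (a, b, c) \<Rightarrow> a \<noteq> b \<and> a \<noteq> c \<and> b \<noteq> c \<and> e i = {a, b, c})"
    using T(2) eT by (auto simp: card_3_iff) metis
  from choice[OF this] obtain v where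
    "\<forall>i. i < N \<longrightarrow> (case v i of (a, b, c) \<Rightarrow> a \<noteq> b \<and> a \<noteq> c \<and> b \<noteq> c \<and> e i = {a, b, c})" ..
  then have v: "case v i of (a, b, c) \<Rightarrow> a \<noteq> b \<and> a \<noteq> c \<and> b \<noteq> c \<and> e i = {a, b, c}" if "i < N" for i
    using that by simp
  define \<phi> where "\<phi> i = (case v i of (a, b, c) \<Rightarrow> triangle_to_sphere a b c)" for i
  have supp: "p \<in> polyhedron Z \<longleftrightarrow> (\<exists>x\<in>e i. p x = 0)" if "i < N" "p \<in> closed_simplex (e i)" for i p
  proof -
    have "p \<in> P"
      using that eT unfolding P_def polyhedron_def by auto
    then have p: "{x. p x \<noteq> 0} \<in> Z \<union> T" "\<And>v. 0 \<le> p v" "sum p {x. p x \<noteq> 0} = 1"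
      unfolding P_def using polyhedron_iff[OF cpx[of T]] by auto
    have sub: "{x. p x \<noteq> 0} \<subseteq> e i"
      using that(2) unfolding closed_simplex_def by auto
    have "{x. p x \<noteq> 0} \<noteq> {}"
      using finite_complex_nonempty[OF cpx[of T] p(1)] by simp
    then have "{x. p x \<noteq> 0} \<in> Z \<longleftrightarrow> {x. p x \<noteq> 0} \<noteq> e i"
      using faces[OF eT[OF that(1)], of "{x. p x \<noteq> 0}"] sub T(3) eT[OF that(1)] by auto
    then show ?thesis
      unfolding polyhedron_iff[OF Z(1)] using p sub by auto
  qed
  have quot: "quotient_map (top_of_set (closed_simplex (e i))) (nsphere 2) (\<phi> i)" if "i < N" for i
    using v[OF that] quotient_map_triangle_to_sphere unfolding \<phi>_def by (auto split: prod.splits)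
  have base: "\<phi> i p = nsphere_base \<longleftrightarrow> p \<in> polyhedron Z" if "i < N" "p \<in> closed_simplex (e i)" for i p
  proof -
    obtain a b c where abc: "v i = (a, b, c)" "a \<noteq> b" "a \<noteq> c" "b \<noteq> c" "e i = {a, b, c}"
      using v[OF \<open>i < N\<close>] by (cases "v i") auto
    show ?thesis
      using triangle_to_sphere_base_iff[OF abc(2-4), of p] that(2)
      unfolding supp[OF that] unfolding \<phi>_def abc(1,5) by simp
  qed
  have inj: "p = q" if "i < N" "p \<in> closed_simplex (e i)" "q \<in> closed_simplex (e i)"
    "\<phi> i p = \<phi> i q" "p \<notin> polyhedron Z" for i p q
  proof -
    obtain a b c where abc: "v i = (a, b, c)" "a \<noteq> b" "a \<noteq> c" "b \<noteq> c" "e i = {a, b, c}"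
      using v[OF \<open>i < N\<close>] by (cases "v i") auto
    have "\<phi> i p \<noteq> nsphere_base"
      using base[of i p] that by simp
    then show ?thesis
      using triangle_to_sphere_inj[OF abc(2-4)] that(2-4) unfolding \<phi>_def abc(1,5) by simp
  qed
  have unique: "i = j" if "i < N" "j < N" "p \<in> closed_simplex (e i)" "p \<in> closed_simplex (e j)"
    "p \<notin> polyhedron Z" for i j p
  proof -
    have "e i = {x. p x \<noteq> 0}" if "i < N" "p \<in> closed_simplex (e i)" for i
      using supp[OF that] that(2) \<open>p \<notin> polyhedron Z\<close> unfolding closed_simplex_def by blast
    then have "e i = e j"
      using that by metis
    then show ?thesis
      using e that(1,2) unfolding bij_betw_def inj_on_def by auto
  qed
  let ?w = "wedge_map (\<lambda>_::nat. nsphere_base)"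
  \<comment> \<open>A point outside \<open>polyhedron Z\<close> is interior to exactly one triangle,
    so \<open>THE\<close> is well defined there. On the boundary of triangle \<open>i\<close> the
    expression \<open>?w (i, \<phi> i p)\<close> is \<open>None\<close> as well, which makes the
    next fact hold on all of the closed triangle.\<close>
  define f where "f p = (if p \<in> polyhedron Z then None
      else let i = (THE i. i < N \<and> p \<in> closed_simplex (e i)) in ?w (i, \<phi> i p))" for p
  have f: "f p = ?w (i, \<phi> i p)" if "i < N" "p \<in> closed_simplex (e i)" for i p
  proof (cases "p \<in> polyhedron Z")
    case True
    then show ?thesis
      using base[OF that] unfolding f_def wedge_map_def by simp
  next
    case False
    have "(THE i. i < N \<and> p \<in> closed_simplex (e i)) = i"
      using unique that False by blast
    then show ?thesis
      using False unfolding f_def by simp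
  qed
  have P: "P = polyhedron Z \<union> (\<Union>i<N. closed_simplex (e i))"
    using e unfolding P_def polyhedron_def bij_betw_def by auto
  have fibre: "f p = f q \<longleftrightarrow> p = q \<or> p \<in> polyhedron Z \<and> q \<in> polyhedron Z" if pq: "p \<in> P" "q \<in> P" for p q
  proof -
    have some: "\<exists>i<N. p \<in> closed_simplex (e i) \<and> f p = Some (i, \<phi> i p)" if p: "p \<in> P" "p \<notin> polyhedron Z" for p
    proof -
      obtain i where "i < N" "p \<in> closed_simplex (e i)"
        using p unfolding P by auto
      then show ?thesis
        using f[of i p] base[of i p] p(2) unfolding wedge_map_def by auto
    qed
    have none: "f p = None" if "p \<in> polyhedron Z" for p
      using that unfolding f_def by simp
    show ?thesis
    proof (cases "p \<in> polyhedron Z \<or> q \<in> polyhedron Z")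
      case True
      then show ?thesis
        using none some[of p] some[of q] pq by (metis option.distinct(1))
    next
      case False
      obtain i j where "i < N" "p \<in> closed_simplex (e i)" "f p = Some (i, \<phi> i p)"
        "j < N" "q \<in> closed_simplex (e j)" "f q = Some (j, \<phi> j q)"
        using some[OF pq(1)] some[OF pq(2)] False by blast
      then show ?thesis
        using inj[of i p q] False by auto
    qed
  qed
  have ne: "polyhedron Z \<noteq> {}"
  proof -
    obtain \<sigma> x where "\<sigma> \<in> Z" "x \<in> \<sigma>"
      using Z unfolding finite_complex_def by blast
    then have "{x} \<in> Z"
      using finite_complex_face[OF Z(1)] by blast
    then have "(\<lambda>y. if y = x then 1 else 0) \<in> polyhedron Z"
      by (rule polyhedronI) auto
    then show ?thesis
      by blast
  qed
  let ?W = "wedge_of_spheres N 2"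
  have topW: "topspace ?W = insert None (?w ` ({..<N} \<times> topspace (nsphere 2)))"
    unfolding wedge_of_spheres_def topspace_wedge_sum by (simp add: o_def)
  have surj: "f ` P = topspace ?W"
  proof -
    have "f ` closed_simplex (e i) = (\<lambda>s. ?w (i, s)) ` topspace (nsphere 2)" if "i < N" for i
    proof -
      have "\<phi> i ` closed_simplex (e i) = topspace (nsphere 2)"
        using quotient_imp_surjective_map[OF quot[OF that]] by simp
      then have "(\<lambda>s. ?w (i, s)) ` topspace (nsphere 2) = (\<lambda>p. ?w (i, \<phi> i p)) ` closed_simplex (e i)"
        by (metis image_image)
      then show ?thesis
        using f[OF that] by simp
    qed
    moreover have "f ` polyhedron Z = {None}"
      using ne unfolding f_def by auto
    ultimately have "f ` P = {None} \<union> (\<Union>i<N. (\<lambda>s. ?w (i, s)) ` topspace (nsphere 2))"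
      unfolding P by (simp add: image_Un image_UN)
    then show ?thesis
      unfolding topW by auto
  qed
  \<comment> \<open>Back to the weak topology, in which openness of a preimage can be tested on one
    closed simplex at a time.\<close>
  have X: "top_of_set P = geometric_realization (Z \<union> T)"
    unfolding P_def using geometric_realization_finite[OF cpx[of T]] by simp
  have open_iff: "openin (top_of_set P) {p \<in> P. f p \<in> U} \<longleftrightarrow> openin ?W U" if U: "U \<subseteq> topspace ?W" for U
  proof -
    let ?F = "{p \<in> P. f p \<in> U}"
    let ?V = "\<lambda>i. {s \<in> topspace (nsphere 2). ?w (i, s) \<in> U}"
    have PZ: "closed_simplex \<sigma> \<subseteq> polyhedron Z" if "\<sigma> \<in> Z" for \<sigma>
      using that unfolding polyhedron_def by auto
    have low: "openin (top_of_set (closed_simplex \<sigma>)) (?F \<inter> closed_simplex \<sigma>)" if "\<sigma> \<in> Z" for \<sigma>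
    proof -
      have "?F \<inter> closed_simplex \<sigma> = (if None \<in> U then closed_simplex \<sigma> else {})"
        using PZ[OF that] unfolding P f_def by auto
      then show ?thesis
        by simp
    qed
    have high: "openin (top_of_set (closed_simplex (e i))) (?F \<inter> closed_simplex (e i))
        \<longleftrightarrow> openin (nsphere 2) (?V i)" if "i < N" for i
    proof -
      have "\<phi> i p \<in> topspace (nsphere 2)" if "p \<in> closed_simplex (e i)" for p
        using quotient_imp_surjective_map[OF quot[OF \<open>i < N\<close>]] that by auto
      then have "?F \<inter> closed_simplex (e i) = {p \<in> topspace (top_of_set (closed_simplex (e i))). \<phi> i p \<in> ?V i}"
        using f[OF that] that unfolding P by auto
      moreover have "openin (top_of_set (closed_simplex (e i)))
          {p \<in> topspace (top_of_set (closed_simplex (e i))). \<phi> i p \<in> ?V i} \<longleftrightarrow> openin (nsphere 2) (?V i)"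
        using quot[OF that, unfolded quotient_map_def, THEN conjunct2, rule_format, of "?V i"] by simp
      ultimately show ?thesis
        by (simp only:)
    qed
    have "openin (top_of_set P) ?F \<longleftrightarrow>
        (\<forall>\<sigma>\<in>Z \<union> T. openin (top_of_set (closed_simplex \<sigma>)) (?F \<inter> closed_simplex \<sigma>))"
      unfolding X openin_geometric_realization unfolding P_def polyhedron_def by auto
    also have "\<dots> \<longleftrightarrow> (\<forall>\<sigma>\<in>T. openin (top_of_set (closed_simplex \<sigma>)) (?F \<inter> closed_simplex \<sigma>))"
      using low by (auto simp: ball_Un)
    also have "\<dots> \<longleftrightarrow> (\<forall>i<N. openin (top_of_set (closed_simplex (e i))) (?F \<inter> closed_simplex (e i)))"
    proof -
      have "T = e ` {..<N}"
        using e unfolding bij_betw_def by simp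
      then show ?thesis
        by auto
    qed
    also have "\<dots> \<longleftrightarrow> (\<forall>i<N. openin (nsphere 2) (?V i))"
      using high by simp
    also have "\<dots> \<longleftrightarrow> openin ?W U"
    proof -
      have "{x. (i, x) \<in> {z \<in> Sigma {..<N} (\<lambda>_. topspace (nsphere 2)). ?w z \<in> U}} = ?V i" if "i < N" for i
        using that by auto
      moreover have "U \<subseteq> insert None (?w ` topspace (sum_topology (\<lambda>_. nsphere 2) {..<N}))"
        using U unfolding topW by (simp add: o_def)
      ultimately show ?thesis
        unfolding wedge_of_spheres_def openin_wedge_sum openin_sum_topology
        by (auto simp: o_def)
    qed
    finally show ?thesis .
  qed
  have quotient: "quotient_map (top_of_set P) ?W f"
    unfolding quotient_map_def using surj open_iff by simp
  obtain a h where h: "continuous_map (prod_topology (top_of_set {0..1::real}) (top_of_set (polyhedron Z)))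
      (top_of_set (polyhedron Z)) h" "\<And>p. h (0, p) = p" "\<And>p. h (1, p) = a"
    using contr unfolding contractible_space_def homotopic_with_def by auto
  have h': "continuous_on ({0..1} \<times> polyhedron Z) h" "h ` ({0..1} \<times> polyhedron Z) \<subseteq> polyhedron Z"
    using h(1) by (auto simp: prod_topology_subtopology_eu)
  obtain H where H: "continuous_on ({0..1::real} \<times> P) H" "H ` ({0..1} \<times> P) \<subseteq> P"
      "\<forall>p\<in>P. H (0, p) = p" "\<forall>t\<in>{0..1}. \<forall>p\<in>polyhedron Z. H (t, p) = h (t, p)"
    using homotopy_extension[OF Z(1) T(1) cpx T(3) h' h(2)] unfolding P_def by blast
  have "top_of_set P homotopy_equivalent_space ?W"
  proof (rule homotopy_equivalent_quotient[OF quotient, where Z = "polyhedron Z" and h = H and a = a])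
    show "continuous_map (prod_topology (top_of_set {0..1}) (top_of_set P)) (top_of_set P) H"
      using H(1,2) by (auto simp: prod_topology_subtopology_eu)
    show "H (t, z) \<in> polyhedron Z" if "t \<in> {0..1}" "z \<in> polyhedron Z" for t z
      using that H(4) h'(2) by auto
  qed (use fibre H(3,4) h(3) in auto)
  then show ?thesis
    unfolding P_def N_def .
qed

section \<open>The clique complex of the Johnson graph\<close>

text \<open>Identifies the simplex with vertex set \<open>B\<close> with a clique, \<open>x\<close>
  standing for \<open>B - {x}\<close>. For \<open>X \<subseteq> B\<close> the inclusions among faces
  are those among the sets \<open>X\<close>.\<close>

definition deletions :: "'a set \<Rightarrow> 'a set \<Rightarrow> 'a set set" where
  "deletions B X = (\<lambda>x. B - {x}) ` X"

lemma inj_on_deletion: "inj_on (\<lambda>x. B - {x}) B"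
  by (auto simp: inj_on_def)

lemma card_deletions: "X \<subseteq> B \<Longrightarrow> card (deletions B X) = card X"
  unfolding deletions_def by (intro card_image inj_on_subset[OF inj_on_deletion])

lemma deletions_subset_iff: "X \<subseteq> B \<Longrightarrow> Y \<subseteq> B \<Longrightarrow> deletions B X \<subseteq> deletions B Y \<longleftrightarrow> X \<subseteq> Y"
  unfolding deletions_def by (rule inj_on_image_subset_iff[OF inj_on_deletion])

lemma deletion_mem_iff: "x \<in> B \<Longrightarrow> X \<subseteq> B \<Longrightarrow> B - {x} \<in> deletions B X \<longleftrightarrow> x \<in> X"
  unfolding deletions_def by (rule inj_on_image_mem_iff[OF inj_on_deletion])

lemma Union_deletions: "a \<in> X \<Longrightarrow> b \<in> X \<Longrightarrow> a \<noteq> b \<Longrightarrow> \<Union>(deletions B X) = B"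
  unfolding deletions_def by blast

lemma Inter_deletions: "X \<noteq> {} \<Longrightarrow> \<Inter>(deletions B X) = B - X"
  unfolding deletions_def by blast

lemma subset_card_Suc_deletion:
  assumes "C \<subseteq> B" "finite B" "card B = Suc (card C)"
  shows "\<exists>x\<in>B. C = B - {x}"
proof -
  have "card (B - C) = 1"
    using assms by (simp add: card_Diff_subset finite_subset)
  then obtain x where "B - C = {x}"
    by (rule card_1_singletonE)
  then show ?thesis
    using assms(1) by (intro bexI[of _ x]) auto
qed

lemma sorted_triple:
  fixes X :: "'a::linorder set"
  assumes "card X = 3"
  shows "\<exists>a b c. c < b \<and> b < a \<and> X = {a, b, c}"
proof -
  obtain x y z where "X = {x, y, z}" "x \<noteq> y" "y \<noteq> z" "x \<noteq> z"
    using assms by (auto simp: card_3_iff)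
  then show ?thesis
    by (metis insert_commute linorder_neqE)
qed

lemma card_Diff_eq_card:
  assumes "finite A" "finite B" "card A = card B"
  shows "card (A - B) = card (B - A)"
  using card_Int_Diff[OF assms(1), of B] card_Int_Diff[OF assms(2), of A] assms(3)
  by (simp add: Int_commute)

lemma finite_subsets_of_size: "finite (subsets_of_size n m)"
  unfolding subsets_of_size_def by (rule finite_subset[of _ "Pow {1..m}"]) auto

lemma subsets_of_sizeD:
  assumes "A \<in> subsets_of_size n m"
  shows "finite A" "card A = n" "A \<subseteq> {1..m}"
  using assms finite_subset unfolding subsets_of_size_def by auto

text \<open>For sets of equal size the symmetric difference has \<open>2 * card (A - B)\<close>
  elements. Distance at most 2 thus means equality or the exchange of one element, i.e. adjacency in
  the Johnson graph.\<close>

lemma vietoris_rips_subsets_of_size_iff: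
  "\<rho> \<in> vietoris_rips (subsets_of_size n m) set_distance 2 \<longleftrightarrow>
     \<rho> \<noteq> {} \<and> \<rho> \<subseteq> subsets_of_size n m \<and> (\<forall>A\<in>\<rho>. \<forall>B\<in>\<rho>. card (A - B) \<le> 1)"
proof -
  have dist: "set_distance A B = 2 * real (card (A - B))"
    if "A \<in> subsets_of_size n m" "B \<in> subsets_of_size n m" for A B
  proof -
    have "card (sym_diff A B) = card (A - B) + card (B - A)"
      using that by (intro card_Un_disjoint) (auto dest: subsets_of_sizeD(1))
    moreover have "card (B - A) = card (A - B)"
      using that by (intro card_Diff_eq_card) (auto dest: subsets_of_sizeD)
    ultimately show ?thesis
      unfolding set_distance_def by simp
  qed
  have "metric_diameter set_distance \<rho> \<le> 2 \<longleftrightarrow> (\<forall>A\<in>\<rho>. \<forall>B\<in>\<rho>. card (A - B) \<le> 1)"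
    if \<rho>: "\<rho> \<noteq> {}" "\<rho> \<subseteq> subsets_of_size n m"
  proof -
    have fin: "finite \<rho>"
      using \<rho>(2) finite_subsets_of_size finite_subset by blast
    have "metric_diameter set_distance \<rho> \<le> 2 \<longleftrightarrow> (\<forall>z\<in>\<rho> \<times> \<rho>. (case z of (A, B) \<Rightarrow> set_distance A B) \<le> 2)"
      unfolding metric_diameter_def using \<rho>(1) fin by (simp add: cSUP_le_iff)
    also have "\<dots> \<longleftrightarrow> (\<forall>A\<in>\<rho>. \<forall>B\<in>\<rho>. set_distance A B \<le> 2)"
      by auto
    also have "\<dots> \<longleftrightarrow> (\<forall>A\<in>\<rho>. \<forall>B\<in>\<rho>. card (A - B) \<le> 1)"
      using \<rho>(2) dist by (auto simp: subset_iff)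
    finally show ?thesis .
  qed
  then show ?thesis
    unfolding vietoris_rips_def using finite_subsets_of_size finite_subset by blast
qed

lemma polyhedron_singleton: "polyhedron {{v}} = {\<lambda>x. if x = v then 1 else 0}"
  unfolding polyhedron_def closed_simplex_def by (auto simp: fun_eq_iff)

context
  fixes n m :: nat
begin

section \<open>Gapped and critical triangles\<close>

definition "VR = vietoris_rips (subsets_of_size n m) set_distance 2"

definition ordered_triple :: "nat set \<Rightarrow> nat \<Rightarrow> nat \<Rightarrow> nat \<Rightarrow> bool" where
  "ordered_triple B a b c \<longleftrightarrow> B \<in> subsets_of_size (Suc n) m \<and> a \<in> B \<and> b \<in> B \<and> c \<in> B \<and> c < b \<and> b < a"

definition gapped :: "nat set set set" where
  "gapped = {deletions B {a, b, c} | B a b c. ordered_triple B a b c \<and> (\<exists>x\<in>B. b < x \<and> x < a)}"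

definition critical :: "nat set set set" where
  "critical = {deletions B {a, b, c} | B a b c. ordered_triple B a b c \<and>
     \<not> (\<exists>x\<in>B. b < x \<and> x < a) \<and> (\<exists>d\<le>m. a < d \<and> d \<notin> B)}"

definition "ungapped_VR = {\<rho> \<in> VR. \<forall>t\<in>gapped. \<not> t \<subseteq> \<rho>}"

definition "noncritical_VR = {\<rho> \<in> ungapped_VR. \<forall>t\<in>critical. \<not> t \<subseteq> \<rho>}"

lemma VR_iff: "\<rho> \<in> VR \<longleftrightarrow> \<rho> \<noteq> {} \<and> \<rho> \<subseteq> subsets_of_size n m \<and> (\<forall>A\<in>\<rho>. \<forall>B\<in>\<rho>. card (A - B) \<le> 1)"
  unfolding VR_def by (rule vietoris_rips_subsets_of_size_iff)

lemma finite_complex_VR: "finite_complex VR"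
proof -
  have "VR \<subseteq> Pow (subsets_of_size n m)"
    using VR_iff by blast
  then have "finite VR"
    by (rule finite_subset) (simp add: finite_subsets_of_size)
  then show ?thesis
    unfolding finite_complex_def
  proof (intro conjI ballI allI impI)
    fix \<sigma> assume \<sigma>: "\<sigma> \<in> VR"
    then show "finite \<sigma>" "\<sigma> \<noteq> {}"
      using finite_subset[OF _ finite_subsets_of_size] VR_iff by blast+
    fix \<rho> assume "\<rho> \<subseteq> \<sigma> \<and> \<rho> \<noteq> {}"
    then show "\<rho> \<in> VR"
      using \<sigma> unfolding VR_iff by blast
  qed
qed

lemma finite_complex_ungapped_VR: "finite_complex ungapped_VR"
  unfolding ungapped_VR_def by (rule finite_complex_avoiding[OF finite_complex_VR])

lemma finite_complex_noncritical_VR: "finite_complex noncritical_VR"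
  unfolding noncritical_VR_def by (rule finite_complex_avoiding[OF finite_complex_ungapped_VR])

lemma deletion_in_V: "B \<in> subsets_of_size (Suc n) m \<Longrightarrow> x \<in> B \<Longrightarrow> B - {x} \<in> subsets_of_size n m"
  unfolding subsets_of_size_def using finite_subset by fastforce

lemma deletions_in_VR:
  assumes "B \<in> subsets_of_size (Suc n) m" "X \<subseteq> B" "X \<noteq> {}"
  shows "deletions B X \<in> VR"
proof -
  have "card (B - {x} - (B - {y})) \<le> 1" for x y
    using card_mono[of "{y}" "B - {x} - (B - {y})"] by auto
  then show ?thesis
    unfolding VR_iff deletions_def using assms deletion_in_V by auto
qed

text \<open>Union and intersection of the three vertices give back \<open>B\<close> and the triple,
  so a triangle encoded as a mere set of vertices determines its labels.\<close>

lemma ordered_tripleD: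
  assumes "ordered_triple B a b c"
  shows "B \<in> subsets_of_size (Suc n) m" "{a, b, c} \<subseteq> B" "c < b" "b < a" "card {a, b, c} = 3" "card (deletions B {a, b, c}) = 3"
    "\<Union>(deletions B {a, b, c}) = B" "\<Inter>(deletions B {a, b, c}) = B - {a, b, c}" "2 \<le> n"
proof -
  show *: "B \<in> subsets_of_size (Suc n) m" "{a, b, c} \<subseteq> B" "c < b" "b < a"
    using assms unfolding ordered_triple_def by auto
  show 3: "card {a, b, c} = 3"
    using * by auto
  show "card (deletions B {a, b, c}) = 3"
    using 3 card_deletions[OF *(2)] by simp
  show "\<Union>(deletions B {a, b, c}) = B"
    using * by (intro Union_deletions[of a _ b]) auto
  show "\<Inter>(deletions B {a, b, c}) = B - {a, b, c}"
    by (rule Inter_deletions) simp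
  show "2 \<le> n"
    using 3 card_mono[OF subsets_of_sizeD(1)[OF *(1)] *(2)] subsets_of_sizeD(2)[OF *(1)] by simp
qed

text \<open>The union of the three vertices is \<open>B\<close>, which forces
  \<open>B \<subseteq> B'\<close>; the sizes agree, so the sets do. A triangle of deletions thus
  belongs to a single \<open>B\<close>.\<close>

lemma ordered_triple_deletions_subset:
  assumes t: "ordered_triple B a b c" and "B' \<in> subsets_of_size (Suc n) m" "X \<subseteq> B'" "deletions B {a, b, c} \<subseteq> deletions B' X"
  shows "B = B'" "{a, b, c} \<subseteq> X"
proof -
  have "B \<subseteq> B'"
    using assms(4) ordered_tripleD(7)[OF t] unfolding deletions_def by blast
  then show "B = B'"
    using subsets_of_sizeD[OF ordered_tripleD(1)[OF t]] subsets_of_sizeD[OF assms(2)]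
    by (intro card_subset_eq) auto
  then show "{a, b, c} \<subseteq> X"
    using assms(3,4) ordered_tripleD(2)[OF t] deletions_subset_iff by metis
qed

lemma gappedE:
  assumes "t \<in> gapped"
  obtains B a b c x where "t = deletions B {a, b, c}" "ordered_triple B a b c" "x \<in> B" "b < x" "x < a"
  using assms unfolding gapped_def by blast

lemma criticalE:
  assumes "t \<in> critical"
  obtains B a b c d where "t = deletions B {a, b, c}" "ordered_triple B a b c"
    "\<not> (\<exists>x\<in>B. b < x \<and> x < a)" "d \<le> m" "a < d" "d \<notin> B"
  using assms unfolding critical_def by blast

lemma gapped_or_critical_triple:
  assumes "t \<in> gapped \<or> t \<in> critical"
  obtains B a b c where "t = deletions B {a, b, c}" "ordered_triple B a b c"
  using assms gappedE criticalE by metis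

lemma card_gapped_or_critical: "t \<in> gapped \<or> t \<in> critical \<Longrightarrow> card t = 3"
  using gapped_or_critical_triple ordered_tripleD(6) by metis

lemma finite_gapped: "finite gapped" and finite_critical: "finite critical"
proof -
  have "t \<in> VR" if "t \<in> gapped \<or> t \<in> critical" for t
    using that
  proof (rule gapped_or_critical_triple)
    fix B a b c
    assume "t = deletions B {a, b, c}" "ordered_triple B a b c"
    then show "t \<in> VR"
      using deletions_in_VR[of B "{a, b, c}"] ordered_tripleD(1,2)[of B a b c] by simp
  qed
  then show "finite gapped" "finite critical"
    using finite_subset[OF _ finite_complex_finite[OF finite_complex_VR]] by blast+
qed

text \<open>The vertices of such a triangle share only \<open>B - {a, b, c}\<close>, one element too
  few. So enlarging a simplex among the sets containing a fixed \<open>(n - 1)\<close>-set never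
  creates a removed triangle.\<close>

lemma not_gapped_or_critical_common:
  assumes t: "t \<in> gapped \<or> t \<in> critical" and A: "card A = n - 1" "\<And>C. C \<in> t \<Longrightarrow> A \<subseteq> C"
  shows False
  using t
proof (rule gapped_or_critical_triple)
  fix B a b c
  assume tB: "t = deletions B {a, b, c}" and o: "ordered_triple B a b c"
  have "A \<subseteq> B - {a, b, c}"
    using A(2) ordered_tripleD(8)[OF o] unfolding tB by blast
  moreover have "finite B" "card B = Suc n"
    using subsets_of_sizeD[OF ordered_tripleD(1)[OF o]] by auto
  moreover have "card (B - {a, b, c}) = card B - 3"
    using card_Diff_subset[of "{a, b, c}" B] ordered_tripleD(2,5)[OF o] by simp
  \<comment> \<open>The intersection has \<open>n - 2\<close> elements; \<open>2 \<le> n\<close>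
    makes this less than \<open>n - 1\<close> in spite of truncated subtraction.\<close>
  ultimately show False
    using card_mono[of "B - {a, b, c}" A] A(1) ordered_tripleD(9)[OF o] by auto
qed

text \<open>A vertex \<open>C\<close> with an element \<open>y\<close> outside \<open>B\<close> can
  differ from each of the three deletions only by \<open>y\<close>. It then avoids \<open>a\<close>,
  \<open>b\<close> and \<open>c\<close> and has at most \<open>1 + (n + 1 - 3)\<close> elements,
  fewer than \<open>n\<close>.\<close>

lemma clique_subset_deletions:
  assumes \<rho>: "\<rho> \<in> VR" and o: "ordered_triple B a b c" and sub: "deletions B {a, b, c} \<subseteq> \<rho>"
  shows "\<rho> \<subseteq> deletions B B"
proof
  fix C
  assume C: "C \<in> \<rho>"
  have V: "C \<in> subsets_of_size n m"
    using \<rho> C by (auto simp: VR_iff)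
  note CV = subsets_of_sizeD[OF V] and BV = subsets_of_sizeD[OF ordered_tripleD(1)[OF o]]
  have "C \<subseteq> B"
  proof (rule ccontr)
    assume "\<not> C \<subseteq> B"
    then obtain y where y: "y \<in> C" "y \<notin> B"
      by blast
    have *: "C - (B - {r}) \<subseteq> {y}" if "r \<in> {a, b, c}" for r
    proof -
      have "B - {r} \<in> \<rho>"
        using sub that unfolding deletions_def by blast
      then have "card (C - (B - {r})) \<le> 1"
        using \<rho> C by (auto simp: VR_iff)
      then have "\<forall>u\<in>C - (B - {r}). \<forall>w\<in>C - (B - {r}). u = w"
        using card_le_Suc0_iff_eq[of "C - (B - {r})"] CV(1) by simp
      then show ?thesis
        using y by blast
    qed
    have "r \<notin> C" if "r \<in> {a, b, c}" for r
      using *[OF that] y that ordered_tripleD(2)[OF o] by blast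
    then have "C \<subseteq> insert y (B - {a, b, c})"
      using *[of a] by blast
    then have "card C \<le> card (insert y (B - {a, b, c}))"
      using BV(1) by (intro card_mono) auto
    also have "\<dots> = Suc (card B - 3)"
      using y BV(1) card_Diff_subset[of "{a, b, c}" B] ordered_tripleD(2,5)[OF o] by simp
    finally show False
      using CV(2) BV(2) ordered_tripleD(9)[OF o] by simp
  qed
  then show "C \<in> deletions B B"
    using subset_card_Suc_deletion[of C B] CV BV unfolding deletions_def by auto
qed

text \<open>A gapped triangle is removed through the vertex \<open>B - p\<close>, where \<open>p\<close> is the predecessor of \<open>a\<close> in \<open>B\<close>.\<close>

lemma VR_collapse:
  "top_of_set (polyhedron VR) homotopy_equivalent_space top_of_set (polyhedron ungapped_VR)"
  unfolding ungapped_VR_def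
proof (rule homotopy_equivalent_collapse_family[OF finite_complex_VR finite_gapped,
      where key = "\<lambda>t. Max (\<Union>t - \<Inter>t)"])
  let ?key = "\<lambda>t::nat set set. Max (\<Union>t - \<Inter>t)"
  \<comment> \<open>The key reads the largest label \<open>a\<close> off the bare set of
    vertices.\<close>
  have key: "?key (deletions B {a, b, c}) = a" if o: "ordered_triple B a b c" for B a b c
  proof -
    have "\<Union>(deletions B {a, b, c}) - \<Inter>(deletions B {a, b, c}) = {a, b, c}"
      using ordered_tripleD(2)[OF o] unfolding ordered_tripleD(7,8)[OF o] by blast
    then show ?thesis
      using ordered_tripleD(3,4)[OF o] by simp
  qed
  show "finite t \<and> t \<noteq> {}" if "t \<in> gapped" for t
    using card_gapped_or_critical[of t] that by (metis card.empty card.infinite zero_neq_numeral)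
  fix t
  assume "t \<in> gapped"
  then obtain B a b c x where t: "t = deletions B {a, b, c}" and o: "ordered_triple B a b c"
    and x: "x \<in> B" "b < x" "x < a"
    by (rule gappedE)
  note oD = ordered_tripleD[OF o]
  \<comment> \<open>The gap element \<open>x\<close> guarantees \<open>b < p\<close>, so
    \<open>B - {p}\<close> is a vertex outside the triangle.\<close>
  define p where "p = Max {y \<in> B. y < a}"
  have finB: "finite {y \<in> B. y < a}"
    using subsets_of_sizeD(1)[OF oD(1)] by simp
  have "p \<in> {y \<in> B. y < a}"
    unfolding p_def using finB x by (intro Max_in) auto
  moreover have "x \<le> p"
    unfolding p_def using finB x by (intro Max_ge) auto
  ultimately have p: "p \<in> B" "p < a" "b < p"
    using x(2) by auto
  have pmax: "y \<le> p" if "y \<in> B" "y < a" for y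
    unfolding p_def using finB that by (intro Max_ge) auto
  have "p \<notin> {a, b, c}"
    using p oD(3,4) by auto
  then have "B - {p} \<notin> t"
    using deletion_mem_iff[OF p(1) oD(2)] unfolding t by simp
  moreover have "insert (B - {p}) \<rho> \<in> VR \<and>
      (\<forall>t'\<in>gapped. ?key t \<le> ?key t' \<longrightarrow> t' \<subseteq> insert (B - {p}) \<rho> \<longrightarrow>
         t' \<subseteq> \<rho> \<or> (\<exists>t''\<in>gapped. t'' \<subseteq> \<rho> \<and> ?key t < ?key t''))"
    if \<rho>: "\<rho> \<in> VR" "t \<subseteq> \<rho>" for \<rho>
  proof
    have sub: "insert (B - {p}) \<rho> \<subseteq> deletions B B"
      using clique_subset_deletions[OF \<rho>(1) o] \<rho>(2) p(1) unfolding t deletions_def by auto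
    have "deletions B B \<in> VR"
      using deletions_in_VR[OF oD(1)] p(1) by auto
    then show "insert (B - {p}) \<rho> \<in> VR"
      using finite_complex_face[OF finite_complex_VR _ sub] by simp
    show "\<forall>t'\<in>gapped. ?key t \<le> ?key t' \<longrightarrow> t' \<subseteq> insert (B - {p}) \<rho> \<longrightarrow>
         t' \<subseteq> \<rho> \<or> (\<exists>t''\<in>gapped. t'' \<subseteq> \<rho> \<and> ?key t < ?key t'')"
    proof (intro ballI impI)
      fix t'
      assume "t' \<in> gapped" and le: "?key t \<le> ?key t'" and sub': "t' \<subseteq> insert (B - {p}) \<rho>"
      then obtain B' a' b' c' x' where t': "t' = deletions B' {a', b', c'}" and o': "ordered_triple B' a' b' c'"
        and x': "x' \<in> B'" "b' < x'" "x' < a'"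
        by (auto elim: gappedE)
      have "t' \<subseteq> deletions B B"
        using sub sub' by blast
      then have BB: "B' = B"
        using ordered_triple_deletions_subset(1)[OF o' oD(1)] unfolding t' by blast
      note oD' = ordered_tripleD[OF o'[unfolded BB]]
      have aa: "a \<le> a'"
        using le key[OF o] key[OF o'] unfolding t t' by simp
      show "t' \<subseteq> \<rho> \<or> (\<exists>t''\<in>gapped. t'' \<subseteq> \<rho> \<and> ?key t < ?key t'')"
      proof (cases "a' = a")
        \<comment> \<open>With the same largest label, \<open>b' < x' \<le> p < a\<close> shows that
          \<open>p\<close> is not a label of \<open>t'\<close>. Hence \<open>t'\<close> does not use
          the added vertex.\<close>
        case True
        have "x' \<le> p"
          using pmax x' True BB by simp
        then have "p \<notin> {a', b', c'}"
          using x' oD'(3,4) True p(2) by auto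
        then have "B - {p} \<notin> t'"
          using deletion_mem_iff[OF p(1) oD'(2)] unfolding t' BB by simp
        then show ?thesis
          using sub' by blast
      next
        \<comment> \<open>A gapped triangle with larger \<open>a'\<close> may use the added vertex.
          But then \<open>{a', b, c}\<close>, gapped because of \<open>a\<close>, was already in
          \<open>\<rho>\<close> and has the larger key.\<close>
        case False
        then have lt: "a < a'"
          using aa by simp
        then have o'': "ordered_triple B a' b c"
          using oD oD'(2) unfolding ordered_triple_def by auto
        have "B - {a'} \<in> insert (B - {p}) \<rho>"
          using sub' unfolding t' BB deletions_def by auto
        moreover have "B - {a'} \<noteq> B - {p}"
        proof
          assume "B - {a'} = B - {p}"
          then have "a' = p"
            using inj_onD[OF inj_on_deletion, of B a' p] oD'(2) p(1) by simp
          then show False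
            using lt p(2) by simp
        qed
        ultimately have "deletions B {a', b, c} \<subseteq> \<rho>"
          using \<rho>(2) unfolding t deletions_def by auto
        moreover have "deletions B {a', b, c} \<in> gapped"
          using o'' lt oD(2,4) unfolding gapped_def by blast
        ultimately show ?thesis
          using key[OF o] key[OF o''] lt unfolding t by metis
      qed
    qed
  qed
  ultimately show "\<exists>v. v \<notin> t \<and> (\<forall>\<rho>\<in>VR. t \<subseteq> \<rho> \<longrightarrow> insert v \<rho> \<in> VR \<and>
      (\<forall>t'\<in>gapped. ?key t \<le> ?key t' \<longrightarrow> t' \<subseteq> insert v \<rho> \<longrightarrow>
         t' \<subseteq> \<rho> \<or> (\<exists>t''\<in>gapped. t'' \<subseteq> \<rho> \<and> ?key t < ?key t'')))"
    by (intro exI[of _ "B - {p}"] conjI ballI impI) simp_all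
qed

text \<open>Critical triangles are maximal here: a fourth vertex \<open>B - {x}\<close> creates a
  gapped triangle wherever \<open>x\<close> lies relative to \<open>c < b < a\<close>, except
  between \<open>b\<close> and \<open>a\<close>, where \<open>B\<close> has no element. Conversely a
  critical triangle is not gapped, as its labels are unique.\<close>

lemma ungapped_VR_eq: "ungapped_VR = noncritical_VR \<union> critical"
proof
  show "ungapped_VR \<subseteq> noncritical_VR \<union> critical"
  proof
    fix \<rho>
    assume \<rho>: "\<rho> \<in> ungapped_VR"
    show "\<rho> \<in> noncritical_VR \<union> critical"
    proof (rule ccontr)
      assume "\<rho> \<notin> noncritical_VR \<union> critical"
      then obtain t where "t \<in> critical" and sub: "t \<subseteq> \<rho>" and "\<rho> \<notin> critical"
        using \<rho> unfolding noncritical_VR_def by blast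
      obtain B a b c d where t: "t = deletions B {a, b, c}" and o: "ordered_triple B a b c"
        and nogap: "\<not> (\<exists>x\<in>B. b < x \<and> x < a)" and "d \<le> m" "a < d" "d \<notin> B"
        using \<open>t \<in> critical\<close> by (rule criticalE)
      note oD = ordered_tripleD[OF o]
      have VR: "\<rho> \<in> VR" and nogapped: "\<And>t. t \<in> gapped \<Longrightarrow> \<not> t \<subseteq> \<rho>"
        using \<rho> unfolding ungapped_VR_def by auto
      have "\<rho> \<noteq> t"
        using \<open>t \<in> critical\<close> \<open>\<rho> \<notin> critical\<close> by blast
      then obtain C where C: "C \<in> \<rho>" "C \<notin> t"
        using sub by blast
      then obtain x where x: "x \<in> B" "C = B - {x}"
        using clique_subset_deletions[OF VR o] sub unfolding t deletions_def by blast
      have mem: "B - {a} \<in> \<rho>" "B - {b} \<in> \<rho>" "B - {c} \<in> \<rho>" "B - {x} \<in> \<rho>"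
        using sub C x unfolding t deletions_def by auto
      have ne: "x \<noteq> a" "x \<noteq> b" "x \<noteq> c"
        using C(2) x(2) unfolding t deletions_def by auto
      have no: "False" if "ordered_triple B a' b' c'" "{a', b', c'} \<subseteq> {a, b, c, x}" "y \<in> B" "b' < y" "y < a'"
        for a' b' c' y
      proof -
        have "deletions B {a', b', c'} \<in> gapped"
          using that unfolding gapped_def by blast
        moreover have "deletions B {a', b', c'} \<subseteq> \<rho>"
          using that(2) mem unfolding deletions_def by auto
        ultimately show False
          using nogapped by blast
      qed
      have B: "a \<in> B" "b \<in> B" "c \<in> B"
        using oD(2) by auto
      consider "a < x" | "x < a" "b < x" | "x < b" "c < x" | "x < c"
        using ne by linarith
      then show False
      proof cases
        case 1
        then show False
          using no[of x b c a] x(1) B oD(1,3,4) unfolding ordered_triple_def by auto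
      next
        case 2
        then show False
          using nogap x(1) by blast
      next
        case 3
        then show False
          using no[of a x c b] x(1) B oD(1,3,4) unfolding ordered_triple_def by auto
      next
        case 4
        then show False
          using no[of a c x b] x(1) B oD(1,3,4) unfolding ordered_triple_def by auto
      qed
    qed
  qed
  have "t \<in> ungapped_VR" if "t \<in> critical" for t
    using that
  proof (rule criticalE)
    fix B a b c d
    assume t: "t = deletions B {a, b, c}" and o: "ordered_triple B a b c"
      and nogap: "\<not> (\<exists>x\<in>B. b < x \<and> x < a)"
    note oD = ordered_tripleD[OF o]
    have "\<not> t' \<subseteq> t" if "t' \<in> gapped" for t'
      using that
    proof (rule gappedE)
      fix B' a' b' c' x
      assume t': "t' = deletions B' {a', b', c'}" and o': "ordered_triple B' a' b' c'"
        and x: "x \<in> B'" "b' < x" "x < a'"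
      show "\<not> t' \<subseteq> t"
      proof
        assume "t' \<subseteq> t"
        then have "B' = B" "{a', b', c'} \<subseteq> {a, b, c}"
          using ordered_triple_deletions_subset[OF o' oD(1,2)] unfolding t t' by blast+
        then have "B' = B" "a' = a" "b' = b"
          using oD(3,4) ordered_tripleD(3,4)[OF o'] by auto
        then show False
          using nogap x by blast
      qed
    qed
    moreover have "t \<in> VR"
      unfolding t using oD(1,2) by (intro deletions_in_VR) auto
    ultimately show "t \<in> ungapped_VR"
      unfolding ungapped_VR_def by blast
  qed
  then show "noncritical_VR \<union> critical \<subseteq> ungapped_VR"
    unfolding noncritical_VR_def by blast
qed

text \<open>All critical simplices have exactly three vertices, so a proper face of one contains
  none.\<close>

lemma critical_proper_face:
  assumes "t \<in> critical" "\<rho> \<subset> t" "\<rho> \<noteq> {}"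
  shows "\<rho> \<in> noncritical_VR"
proof -
  have "\<rho> \<in> ungapped_VR"
    using finite_complex_face[OF finite_complex_ungapped_VR, of t \<rho>] assms ungapped_VR_eq by blast
  moreover have "\<not> t' \<subseteq> \<rho>" if "t' \<in> critical" for t'
  proof
    assume "t' \<subseteq> \<rho>"
    moreover have "finite t"
      using card_gapped_or_critical[of t] assms(1) by (metis card.infinite zero_neq_numeral)
    ultimately have "card t' < card t"
      using assms(2) by (intro psubset_card_mono) auto
    then show False
      using card_gapped_or_critical that assms(1) by fastforce
  qed
  ultimately show ?thesis
    unfolding noncritical_VR_def by blast
qed

end

section \<open>Contracting the noncritical part\<close>

context
  fixes n m :: nat
  assumes nm: "n \<le> m"
begin

text \<open>The filtration of the sweep: \<open>p = m\<close> imposes no condition, and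
  \<open>p = m - n\<close> leaves room for the vertex \<open>{m - n<..m}\<close> only.\<close>

definition "top_part p = {\<rho> \<in> noncritical_VR n m. \<forall>C\<in>\<rho>. {p<..m} \<subseteq> C}"

lemma finite_complex_top_part: "finite_complex (top_part p)"
  unfolding finite_complex_def
proof (intro conjI ballI allI impI)
  note Z = finite_complex_noncritical_VR[of n m]
  show "finite (top_part p)"
    unfolding top_part_def using finite_complex_finite[OF Z] by simp
  fix \<sigma> assume \<sigma>: "\<sigma> \<in> top_part p"
  then have \<sigma>Z: "\<sigma> \<in> noncritical_VR n m"
    unfolding top_part_def by simp
  show "finite \<sigma>" "\<sigma> \<noteq> {}"
    using finite_complex_finite_simplex[OF Z \<sigma>Z] finite_complex_nonempty[OF Z \<sigma>Z] .
  fix \<rho> assume "\<rho> \<subseteq> \<sigma> \<and> \<rho> \<noteq> {}"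
  then show "\<rho> \<in> top_part p"
    using \<sigma> finite_complex_face[OF Z \<sigma>Z, of \<rho>] unfolding top_part_def by blast
qed

lemma noncritical_VR_iff:
  "\<rho> \<in> noncritical_VR n m \<longleftrightarrow> \<rho> \<in> VR n m \<and> (\<forall>t. t \<in> gapped n m \<or> t \<in> critical n m \<longrightarrow> \<not> t \<subseteq> \<rho>)"
  unfolding noncritical_VR_def ungapped_VR_def by blast

text \<open>Otherwise \<open>C\<close>, \<open>D\<close>, \<open>X\<close> would be the deletions of
  three elements \<open>x\<close>, \<open>y\<close>, \<open>d\<close> from
  \<open>B = C \<union> D\<close>. Each of these is absent from some vertex, while all vertices
  contain \<open>{q<..m}\<close>, and \<open>q \<notin> B\<close>; so all three are below
  \<open>q\<close>. The triangle is then gapped, or critical with \<open>q\<close> as the missing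
  element.\<close>

lemma clique_contains_common:
  assumes \<rho>: "\<rho> \<in> top_part q" and q: "q \<le> m" and CD: "C \<in> \<rho>" "D \<in> \<rho>" "C \<noteq> D" "q \<notin> C" "q \<notin> D" and X: "X \<in> \<rho>"
  shows "C \<inter> D \<subseteq> X"
proof (rule ccontr)
  assume "\<not> C \<inter> D \<subseteq> X"
  then obtain d where d: "d \<in> C" "d \<in> D" "d \<notin> X"
    by blast
  have \<rho>Z: "\<rho> \<in> VR n m" "\<And>t. t \<in> gapped n m \<or> t \<in> critical n m \<Longrightarrow> \<not> t \<subseteq> \<rho>"
    using \<rho> unfolding top_part_def noncritical_VR_iff by auto
  have V: "C \<in> subsets_of_size n m" "D \<in> subsets_of_size n m" "X \<in> subsets_of_size n m"
    using \<rho>Z(1) CD X unfolding VR_iff by auto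
  note CV = subsets_of_sizeD[OF V(1)] and DV = subsets_of_sizeD[OF V(2)] and XV = subsets_of_sizeD[OF V(3)]
  have small: "card (A - B) \<le> 1" if "A \<in> \<rho>" "B \<in> \<rho>" for A B
    using \<rho>Z(1) that unfolding VR_iff by blast
  have single: "A - B = {y}" if "A \<in> \<rho>" "B \<in> \<rho>" "y \<in> A" "y \<notin> B" "finite A" for A B y
    using small[OF that(1,2)] that(3-5) card_le_Suc0_iff_eq[of "A - B"] by auto
  have "\<exists>y. y \<in> C - D"
    using CD(3) CV DV by (metis card_subset_eq Diff_eq_empty_iff ex_in_conv)
  then obtain y where y: "y \<in> C" "y \<notin> D"
    by blast
  have "\<exists>x. x \<in> D - C"
    using CD(3) CV DV by (metis card_subset_eq Diff_eq_empty_iff ex_in_conv)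
  then obtain x where x: "x \<in> D" "x \<notin> C"
    by blast
  define B where "B = insert x C"
  have yy: "C - D = {y}" and xx: "D - C = {x}" and dd: "C - X = {d}" "D - X = {d}"
    using single CD X y x d CV(1) DV(1) by blast+
  have CB: "C = B - {x}" and DB: "D = B - {y}"
    using x y yy xx unfolding B_def by blast+
  have cardB: "card B = Suc n" "finite B"
    using CV(1,2) x(2) unfolding B_def by auto
  have "B - {d} \<subseteq> X"
    using dd CB DB x y by blast
  moreover have "card (B - {d}) = card X"
    using cardB d(1) XV(2) unfolding B_def by simp
  ultimately have XB: "X = B - {d}"
    using XV(1) card_subset_eq by blast
  have mem: "x \<in> B" "y \<in> B" "d \<in> B"
    using x y d unfolding B_def by auto
  have ne: "x \<noteq> y" "x \<noteq> d" "y \<noteq> d"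
    using x y d by auto
  then have "card {x, y, d} = 3"
    by simp
  then obtain a b c where abc: "c < b" "b < a" "{x, y, d} = {a, b, c}"
    using sorted_triple by blast
  have "B \<in> subsets_of_size (Suc n) m"
    using cardB CV(3) DV(3) x(1) unfolding subsets_of_size_def B_def by auto
  then have o: "ordered_triple n m B a b c"
    unfolding ordered_triple_def using abc mem by (metis insertCI insertE singletonD)
  have "deletions B {x, y, d} \<subseteq> \<rho>"
    using CD(1,2) X CB DB XB unfolding deletions_def by auto
  then have sub: "deletions B {a, b, c} \<subseteq> \<rho>"
    by (simp only: abc(3))
  have top: "{q<..m} \<subseteq> C" "{q<..m} \<subseteq> D" "{q<..m} \<subseteq> X"
    using \<rho> CD X unfolding top_part_def by auto
  have qB: "q \<notin> B"
    using CD(4,5) x(1) unfolding B_def by auto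
  have lt: "r < q" if "r \<in> {x, y, d}" for r
  proof -
    have "r \<notin> {q<..m}"
      using top that CB DB XB by blast
    moreover have "r \<noteq> q" "r \<le> m"
      using that mem qB ordered_tripleD(1)[OF o] subsets_of_sizeD(3) by fastforce+
    ultimately show "r < q"
      by auto
  qed
  have "a < q"
    using lt[of a] abc(3) by simp
  then have "deletions B {a, b, c} \<in> gapped n m \<or> deletions B {a, b, c} \<in> critical n m"
    using o q qB unfolding gapped_def critical_def by blast
  then show False
    using \<rho>Z(2) sub by blast
qed

section \<open>One stage of the sweep: removing the vertices that miss \<open>q\<close>\<close>

text \<open>Vertices that miss \<open>q\<close> may be adjacent, which prevents removing them
  directly. These edges go first; in \<open>forest_part\<close> such vertices are pairwise
  nonadjacent.\<close>

definition "top_edges q = {{C, D} | C D. C \<in> subsets_of_size n m \<and> D \<in> subsets_of_size n m \<and> C \<noteq> D \<and> card (C - D) \<le> 1 \<and>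
   q \<notin> C \<and> q \<notin> D \<and> {q<..m} \<subseteq> C \<and> {q<..m} \<subseteq> D}"

definition "top_vertices q = {{C} | C. C \<in> subsets_of_size n m \<and> q \<notin> C \<and> {q<..m} \<subseteq> C}"

definition "forest_part q = {\<rho> \<in> top_part q. \<forall>t\<in>top_edges q. \<not> t \<subseteq> \<rho>}"

lemma finite_top_edges: "finite (top_edges q)" and finite_top_vertices: "finite (top_vertices q)"
proof -
  have "top_edges q \<subseteq> Pow (subsets_of_size n m)" "top_vertices q \<subseteq> Pow (subsets_of_size n m)"
    unfolding top_edges_def top_vertices_def by auto
  then show "finite (top_edges q)" "finite (top_vertices q)"
    using finite_subset[of _ "Pow (subsets_of_size n m)"] finite_subsets_of_size[of n m] by auto
qed

text \<open>The cone vertex for \<open>{C, D}\<close> is \<open>insert q (C \<inter> D)\<close>. All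
  vertices of a simplex over this edge contain the \<open>(n - 1)\<close>-set
  \<open>C \<inter> D\<close>, so adding it keeps a clique and creates no gapped or critical
  triangle. It contains \<open>q\<close> and so lies on no edge of \<open>top_edges q\<close>; a
  constant key suffices.\<close>

lemma top_part_collapse_edges:
  assumes q: "0 < q" "q \<le> m"
  shows "top_of_set (polyhedron (top_part q)) homotopy_equivalent_space
         top_of_set (polyhedron (forest_part q))"
  unfolding forest_part_def
proof (rule homotopy_equivalent_collapse_family[OF finite_complex_top_part finite_top_edges,
      where key = "\<lambda>_. 0"])
  show "finite t \<and> t \<noteq> {}" if "t \<in> top_edges q" for t
    using that unfolding top_edges_def by auto
  fix t
  assume "t \<in> top_edges q"
  then obtain C D where t: "t = {C, D}" and CD: "C \<in> subsets_of_size n m" "D \<in> subsets_of_size n m" "C \<noteq> D" "card (C - D) \<le> 1"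
      "q \<notin> C" "q \<notin> D" "{q<..m} \<subseteq> C" "{q<..m} \<subseteq> D"
    unfolding top_edges_def by blast
  note CV = subsets_of_sizeD[OF CD(1)] and DV = subsets_of_sizeD[OF CD(2)]
  define A where "A = C \<inter> D"
  have A: "finite A" "q \<notin> A" "{q<..m} \<subseteq> A"
    using CV(1) CD unfolding A_def by auto
  have "C - D \<noteq> {}"
    using CD(3) CV DV by (metis card_subset_eq Diff_eq_empty_iff)
  then have "card (C - D) \<noteq> 0"
    using CV(1) by simp
  then have cardA: "Suc (card A) = n"
    using CD(4) card_Int_Diff[OF CV(1), of D] CV(2) unfolding A_def by simp
  let ?v = "insert q A"
  have vV: "?v \<in> subsets_of_size n m"
    using cardA A CV(3) q unfolding subsets_of_size_def A_def by auto
  have new: "s \<subseteq> \<rho>" if s: "s \<in> top_edges q" "s \<subseteq> insert ?v \<rho>" for s \<rho>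
  proof -
    have "?v \<notin> s"
      using s(1) unfolding top_edges_def by blast
    then show ?thesis
      using s(2) by blast
  qed
  have mem: "insert ?v \<rho> \<in> top_part q" if \<rho>: "\<rho> \<in> top_part q" "t \<subseteq> \<rho>" for \<rho>
  proof -
    have AX: "A \<subseteq> X" if "X \<in> \<rho>" for X
      unfolding A_def using clique_contains_common[OF \<rho>(1) q(2) _ _ CD(3,5,6) that] \<rho>(2) unfolding t by simp
    have \<rho>Z: "\<rho> \<in> VR n m" "\<And>X. X \<in> \<rho> \<Longrightarrow> {q<..m} \<subseteq> X"
      using \<rho>(1) unfolding top_part_def noncritical_VR_iff by auto
    have "card (X - Y) \<le> 1" if XY: "X \<in> insert ?v \<rho>" "Y \<in> insert ?v \<rho>" for X Y
    proof -
      have sub: "A \<subseteq> X" "A \<subseteq> Y"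
        using AX XY by auto
      have X: "X \<in> subsets_of_size n m"
        using XY(1) vV \<rho>Z(1) unfolding VR_iff by auto
      have "card (X - Y) \<le> card (X - A)"
        using sub subsets_of_sizeD(1)[OF X] by (intro card_mono) auto
      also have "\<dots> = card X - card A"
        using sub A(1) by (simp add: card_Diff_subset)
      finally show ?thesis
        using subsets_of_sizeD(2)[OF X] cardA by simp
    qed
    then have "insert ?v \<rho> \<in> VR n m"
      using \<rho>Z(1) vV unfolding VR_iff by blast
    moreover have "\<not> s \<subseteq> insert ?v \<rho>" if s: "s \<in> gapped n m \<or> s \<in> critical n m" for s
    proof
      assume "s \<subseteq> insert ?v \<rho>"
      then have "A \<subseteq> X" if "X \<in> s" for X
        using that AX by blast
      moreover have "card A = n - 1"
        using cardA by simp
      ultimately show False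
        using not_gapped_or_critical_common[OF s] by blast
    qed
    moreover have "\<forall>X\<in>insert ?v \<rho>. {q<..m} \<subseteq> X"
      using A(3) \<rho>Z(2) by blast
    ultimately show ?thesis
      unfolding top_part_def noncritical_VR_iff by blast
  qed
  have vt: "?v \<notin> t"
    using CD(5,6) unfolding t by blast
  show "\<exists>v. v \<notin> t \<and> (\<forall>\<rho>\<in>top_part q. t \<subseteq> \<rho> \<longrightarrow> insert v \<rho> \<in> top_part q \<and>
      (\<forall>t'\<in>top_edges q. 0 \<le> (0::nat) \<longrightarrow> t' \<subseteq> insert v \<rho> \<longrightarrow>
         t' \<subseteq> \<rho> \<or> (\<exists>t''\<in>top_edges q. t'' \<subseteq> \<rho> \<and> (0::nat) < 0)))"
  proof (intro exI[of _ ?v] conjI ballI impI disjI1)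
    show "?v \<notin> t"
      by (rule vt)
    fix \<rho> assume \<rho>: "\<rho> \<in> top_part q" "t \<subseteq> \<rho>"
    show "insert ?v \<rho> \<in> top_part q"
      using mem[OF \<rho>] .
    fix s assume "s \<in> top_edges q" "s \<subseteq> insert ?v \<rho>"
    then show "s \<subseteq> \<rho>"
      by (rule new)
  qed
qed

text \<open>Every neighbour of \<open>C\<close> contains \<open>q\<close>, hence is
  \<open>B - {x}\<close> with \<open>B = insert q C\<close> and \<open>x < q\<close>. Of two such
  neighbours in one simplex, the one with larger \<open>x\<close> must be \<open>B - {x0}\<close>,
  where \<open>x0\<close> is the predecessor of \<open>q\<close> in \<open>B\<close>, or else a
  gapped triangle appears. So the link of \<open>C\<close> is a cone with apex
  \<open>B - {x0}\<close>.\<close>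

lemma forest_part_star:
  assumes q: "m - n < q" "q \<le> m" and C: "C \<in> subsets_of_size n m" "q \<notin> C" "{q<..m} \<subseteq> C"
  shows "\<exists>v. q \<in> v \<and> (\<forall>\<rho>\<in>forest_part q. C \<in> \<rho> \<longrightarrow> insert v \<rho> \<in> forest_part q)"
proof -
  note CV = subsets_of_sizeD[OF C(1)]
  define B where "B = insert q C"
  have BV: "B \<in> subsets_of_size (Suc n) m"
    using CV C(2) q unfolding subsets_of_size_def B_def by auto
  have CB: "C = B - {q}"
    using C(2) unfolding B_def by simp
  define S where "S = {x \<in> C. x < q}"
  have finS: "finite S"
    using CV(1) unfolding S_def by simp
  \<comment> \<open>This is where \<open>m - n < q\<close> enters: without elements below
    \<open>q\<close>, the set \<open>C\<close> would fit into the \<open>m - q < n\<close> elements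
    above \<open>q\<close>.\<close>
  have "S \<noteq> {}"
  proof
    assume "S = {}"
    have "y \<in> {q<..m}" if "y \<in> C" for y
    proof -
      have "\<not> y < q"
        using \<open>S = {}\<close> that unfolding S_def by blast
      moreover have "y \<noteq> q" "y \<le> m"
        using that C(2) CV(3) by fastforce+
      ultimately show ?thesis
        by simp
    qed
    then have "C \<subseteq> {q<..m}"
      by blast
    then have "n \<le> m - q"
      using card_mono[of "{q<..m}" C] CV(2) by simp
    then show False
      using q nm by linarith
  qed
  define x0 where "x0 = Max S"
  have x0: "x0 \<in> C" "x0 < q" "\<And>x. x \<in> S \<Longrightarrow> x \<le> x0"
    using Max_in[OF finS \<open>S \<noteq> {}\<close>] Max_ge[OF finS] unfolding x0_def S_def by auto
  let ?v = "B - {x0}"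
  have qv: "q \<in> ?v"
    using x0(2) unfolding B_def by simp
  have ins: "insert ?v \<rho> \<in> forest_part q" if \<rho>: "\<rho> \<in> forest_part q" and C\<rho>: "C \<in> \<rho>" for \<rho>
  proof -
    have \<rho>VR: "\<rho> \<in> VR n m" and notri: "\<And>t. t \<in> gapped n m \<or> t \<in> critical n m \<Longrightarrow> \<not> t \<subseteq> \<rho>"
      and top: "\<And>X. X \<in> \<rho> \<Longrightarrow> {q<..m} \<subseteq> X" and noedge: "\<And>t. t \<in> top_edges q \<Longrightarrow> \<not> t \<subseteq> \<rho>"
      using \<rho> unfolding forest_part_def top_part_def noncritical_VR_iff by auto
    have other: "\<exists>x\<in>S. D = B - {x}" if D: "D \<in> \<rho>" "D \<noteq> C" for D
    proof -
      have DV: "D \<in> subsets_of_size n m"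
        using \<rho>VR D(1) unfolding VR_iff by blast
      note DV' = subsets_of_sizeD[OF DV]
      have "card (C - D) \<le> 1" "card (D - C) \<le> 1"
        using \<rho>VR D(1) C\<rho> unfolding VR_iff by auto
      have "q \<in> D"
      proof (rule ccontr)
        assume "q \<notin> D"
        then have "{C, D} \<in> top_edges q"
          unfolding top_edges_def using C DV D(2) top[OF D(1)] \<open>card (C - D) \<le> 1\<close> by blast
        then show False
          using noedge C\<rho> D(1) by blast
      qed
      then have "D - C \<subseteq> {q}"
        using \<open>card (D - C) \<le> 1\<close> C(2) DV'(1) card_le_Suc0_iff_eq[of "D - C"] by auto
      then have "D \<subseteq> B"
        unfolding B_def by blast
      then obtain x where x: "x \<in> B" "D = B - {x}"
        using subset_card_Suc_deletion[of D B] DV' subsets_of_sizeD[OF BV] by auto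
      have "x \<noteq> q"
        using x(2) \<open>q \<in> D\<close> by blast
      then have "x \<in> C"
        using x(1) unfolding B_def by simp
      moreover have "\<not> q < x"
      proof
        assume "q < x"
        then have "x \<in> {q<..m}"
          using \<open>x \<in> C\<close> CV(3) by auto
        then show False
          using top[OF D(1)] x(2) by blast
      qed
      ultimately show ?thesis
        using x \<open>x \<noteq> q\<close> unfolding S_def by auto
    qed
    have SB: "x \<in> B" "x < q" if "x \<in> S" for x
      using that unfolding S_def B_def by auto
    have "\<exists>x\<in>S. \<forall>D\<in>\<rho>. D = C \<or> D = B - {x0} \<or> D = B - {x}"
    proof (rule ccontr)
      assume neg: "\<not> ?thesis"
      have "x0 \<in> S"
        using x0 unfolding S_def by simp
      then obtain D1 where D1: "D1 \<in> \<rho>" "D1 \<noteq> C" "D1 \<noteq> B - {x0}"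
        using neg by blast
      obtain x1 where x1: "x1 \<in> S" "D1 = B - {x1}"
        using other[OF D1(1,2)] by blast
      obtain D2 where D2: "D2 \<in> \<rho>" "D2 \<noteq> C" "D2 \<noteq> B - {x0}" "D2 \<noteq> B - {x1}"
        using neg x1(1) by blast
      obtain x2 where x2: "x2 \<in> S" "D2 = B - {x2}"
        using other[OF D2(1,2)] by blast
      \<comment> \<open>Together with \<open>C = B - {q}\<close> these are the vertices of the
        triangle with labels \<open>q > x > y\<close>, and \<open>x0\<close> lies in the gap between
        \<open>x\<close> and \<open>q\<close>.\<close>
      have tri: False if "x \<in> S" "y \<in> S" "y < x" "x \<noteq> x0" "B - {x} \<in> \<rho>" "B - {y} \<in> \<rho>" for x y
      proof -
        have "ordered_triple n m B q x y"
          unfolding ordered_triple_def using BV SB that by (simp add: B_def)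
        moreover have "x < x0" "x0 \<in> B"
          using x0(3)[OF that(1)] that(4) x0(1) unfolding B_def by auto
        ultimately have "deletions B {q, x, y} \<in> gapped n m"
          unfolding gapped_def using x0(2) by blast
        moreover have "deletions B {q, x, y} \<subseteq> \<rho>"
          using C\<rho> that(5,6) unfolding deletions_def CB by simp
        ultimately show False
          using notri by blast
      qed
      have "x1 \<noteq> x2" "x1 \<noteq> x0" "x2 \<noteq> x0"
        using D1 D2 x1(2) x2(2) by auto
      then show False
        using tri[of x1 x2] tri[of x2 x1] x1 x2 D1(1) D2(1) by (cases x1 x2 rule: linorder_cases) auto
    qed
    then obtain x where x: "x \<in> S" "\<And>D. D \<in> \<rho> \<Longrightarrow> D = C \<or> D = B - {x0} \<or> D = B - {x}"
      by blast
    let ?X = "{q, x0, x}"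
    have XB: "?X \<subseteq> B"
      using x0(1) SB(1)[OF x(1)] unfolding B_def by auto
    have sub: "insert ?v \<rho> \<subseteq> deletions B ?X"
      using x(2) unfolding deletions_def CB by auto
    have "insert ?v \<rho> \<in> VR n m"
      using finite_complex_face[OF finite_complex_VR deletions_in_VR[OF BV XB] sub] by simp
    moreover have "\<not> t \<subseteq> insert ?v \<rho>" if t: "t \<in> gapped n m \<or> t \<in> critical n m" for t
    proof
      assume "t \<subseteq> insert ?v \<rho>"
      then have tX: "t \<subseteq> deletions B ?X"
        using sub by blast
      \<comment> \<open>The only possible new triangle has \<open>a = q\<close> and
        \<open>b = x0\<close>. It has no gap because \<open>x0\<close> is the predecessor of
        \<open>q\<close>, and it is not critical because \<open>B\<close> contains everything above
        \<open>q\<close>.\<close>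
      have key: "B' = B \<and> a = q \<and> b = x0" if "t = deletions B' {a, b, c}" and o: "ordered_triple n m B' a b c" for B' a b c
      proof -
        have "B' = B" "{a, b, c} \<subseteq> ?X"
          using ordered_triple_deletions_subset[OF o BV XB] tX that(1) by auto
        then show ?thesis
          using ordered_tripleD(3,4)[OF o] x0(2) x0(3)[OF x(1)] by auto
      qed
      from t show False
      proof
        assume "t \<in> gapped n m"
        then show False
        proof (rule gappedE)
          fix B' a b c y
          assume "t = deletions B' {a, b, c}" "ordered_triple n m B' a b c" "y \<in> B'" "b < y" "y < a"
          then have "y \<in> B" "x0 < y" "y < q"
            using key by auto
          then show False
            using x0(3)[of y] unfolding S_def B_def by auto
        qed
      next
        assume "t \<in> critical n m"
        then show False
        proof (rule criticalE)
          fix B' a b c d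
          assume "t = deletions B' {a, b, c}" "ordered_triple n m B' a b c" "d \<le> m" "a < d" "d \<notin> B'"
          then have "d \<notin> B" "d \<in> {q<..m}"
            using key by auto
          then show False
            using C(3) unfolding B_def by blast
        qed
      qed
    qed
    moreover have "\<forall>X\<in>insert ?v \<rho>. {q<..m} \<subseteq> X"
      using top C(3) x0(2) unfolding B_def by auto
    moreover have "\<not> t \<subseteq> insert ?v \<rho>" if t: "t \<in> top_edges q" for t
    proof
      have "?v \<notin> t"
        using t qv unfolding top_edges_def by blast
      moreover assume "t \<subseteq> insert ?v \<rho>"
      ultimately show False
        using noedge[OF t] by blast
    qed
    ultimately show ?thesis
      unfolding forest_part_def top_part_def noncritical_VR_iff by blast
  qed
  show ?thesis
    by (intro exI[of _ ?v] conjI ballI impI qv) (rule ins)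
qed

text \<open>The apex found for \<open>C\<close> contains \<open>q\<close>, so it is not itself to be
  removed and a constant key suffices. Once every vertex contains \<open>q\<close>, the conditions
  on \<open>top_edges q\<close> hold automatically.\<close>

lemma forest_part_collapse_vertices:
  assumes q: "m - n < q" "q \<le> m"
  shows "top_of_set (polyhedron (forest_part q)) homotopy_equivalent_space
         top_of_set (polyhedron (top_part (q - 1)))"
proof -
  have "top_of_set (polyhedron (forest_part q)) homotopy_equivalent_space
      top_of_set (polyhedron {\<rho> \<in> forest_part q. \<forall>t\<in>top_vertices q. \<not> t \<subseteq> \<rho>})"
  proof (rule homotopy_equivalent_collapse_family[where key = "\<lambda>_. 0"])
    show "finite_complex (forest_part q)"
      unfolding forest_part_def by (rule finite_complex_avoiding[OF finite_complex_top_part])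
    show "finite (top_vertices q)"
      by (rule finite_top_vertices)
    show "finite t \<and> t \<noteq> {}" if "t \<in> top_vertices q" for t
      using that unfolding top_vertices_def by auto
    fix t
    assume "t \<in> top_vertices q"
    then obtain C where t: "t = {C}" and C: "C \<in> subsets_of_size n m" "q \<notin> C" "{q<..m} \<subseteq> C"
      unfolding top_vertices_def by blast
    obtain v where v: "q \<in> v" "\<And>\<rho>. \<rho> \<in> forest_part q \<Longrightarrow> C \<in> \<rho> \<Longrightarrow> insert v \<rho> \<in> forest_part q"
      using forest_part_star[OF q C] by blast
    have vt: "v \<notin> t"
      using v(1) C(2) unfolding t by blast
    have new: "s \<subseteq> \<rho>" if "s \<in> top_vertices q" "s \<subseteq> insert v \<rho>" for s \<rho>
      using that v(1) unfolding top_vertices_def by blast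
    show "\<exists>v. v \<notin> t \<and> (\<forall>\<rho>\<in>forest_part q. t \<subseteq> \<rho> \<longrightarrow> insert v \<rho> \<in> forest_part q \<and>
      (\<forall>t'\<in>top_vertices q. 0 \<le> (0::nat) \<longrightarrow> t' \<subseteq> insert v \<rho> \<longrightarrow>
         t' \<subseteq> \<rho> \<or> (\<exists>t''\<in>top_vertices q. t'' \<subseteq> \<rho> \<and> (0::nat) < 0)))"
    proof (intro exI[of _ v] conjI ballI impI disjI1)
      show "v \<notin> t"
        by (rule vt)
      fix \<rho> assume "\<rho> \<in> forest_part q" "t \<subseteq> \<rho>"
      then show "insert v \<rho> \<in> forest_part q"
        unfolding t by (intro v(2)) simp_all
      fix s assume "s \<in> top_vertices q" "s \<subseteq> insert v \<rho>"
      then show "s \<subseteq> \<rho>"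
        by (rule new)
    qed
  qed
  also have "{\<rho> \<in> forest_part q. \<forall>t\<in>top_vertices q. \<not> t \<subseteq> \<rho>} = top_part (q - 1)"
  proof -
    have top: "{q - 1<..m} = insert q {q<..m}"
      using q by auto
    have "q \<in> C" if \<rho>: "\<rho> \<in> top_part q" "\<forall>t\<in>top_vertices q. \<not> t \<subseteq> \<rho>" "C \<in> \<rho>" for \<rho> C
    proof (rule ccontr)
      assume "q \<notin> C"
      moreover have "C \<in> subsets_of_size n m" "{q<..m} \<subseteq> C"
        using \<rho>(1,3) unfolding top_part_def noncritical_VR_iff VR_iff by auto
      ultimately have "{C} \<in> top_vertices q"
        unfolding top_vertices_def by blast
      then show False
        using \<rho>(2,3) by blast
    qed
    moreover have "\<not> t \<subseteq> \<rho>" if "\<And>C. C \<in> \<rho> \<Longrightarrow> q \<in> C" "t \<in> top_edges q \<or> t \<in> top_vertices q" for t \<rho>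
      using that unfolding top_edges_def top_vertices_def by blast
    ultimately show ?thesis
      unfolding forest_part_def top_part_def top by blast
  qed
  finally show ?thesis .
qed

lemma contractible_top_part:
  assumes "m - n \<le> p" "p \<le> m"
  shows "contractible_space (top_of_set (polyhedron (top_part p)))"
  using assms
proof (induction p rule: dec_induct)
  case base
  let ?C = "{m - n<..m}"
  have "?C \<in> subsets_of_size n m"
    using nm unfolding subsets_of_size_def by auto
  have only: "C = ?C" if "C \<in> subsets_of_size n m" "?C \<subseteq> C" for C
    using card_subset_eq[OF _ that(2)] subsets_of_sizeD[OF that(1)] nm by simp
  have "top_part (m - n) \<subseteq> {{?C}}"
  proof
    fix \<rho>
    assume "\<rho> \<in> top_part (m - n)"
    then have "\<rho> \<noteq> {}" "\<And>C. C \<in> \<rho> \<Longrightarrow> C \<in> subsets_of_size n m \<and> ?C \<subseteq> C"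
      unfolding top_part_def noncritical_VR_iff VR_iff by auto
    then have "\<rho> = {?C}"
      using only by blast
    then show "\<rho> \<in> {{?C}}"
      by simp
  qed
  \<comment> \<open>An inclusion into one point is enough for contractibility, which also holds for
    the empty space. Nonemptiness of the noncritical complex is proved separately.\<close>
  then have "polyhedron (top_part (m - n)) \<subseteq> {\<lambda>x. if x = ?C then 1 else 0}"
    using polyhedron_mono polyhedron_singleton by metis
  then show ?case
    using contractible_space_subset_singleton[of "top_of_set (polyhedron (top_part (m - n)))"] by simp
next
  case (step p)
  have "top_of_set (polyhedron (top_part (Suc p))) homotopy_equivalent_space
      top_of_set (polyhedron (forest_part (Suc p)))"
    using step by (intro top_part_collapse_edges) auto
  also have "\<dots> homotopy_equivalent_space top_of_set (polyhedron (top_part (Suc p - 1)))"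
    using step by (intro forest_part_collapse_vertices) auto
  finally show ?case
    using step homotopy_equivalent_space_contractibility by fastforce
qed

lemma contractible_noncritical_VR: "contractible_space (top_of_set (polyhedron (noncritical_VR n m)))"
proof -
  have "top_part m = noncritical_VR n m"
    unfolding top_part_def by simp
  then show ?thesis
    using contractible_top_part[of m] by simp
qed

text \<open>Ensures that the base point of the wedge has a preimage under the quotient map.\<close>

lemma noncritical_VR_nonempty: "noncritical_VR n m \<noteq> {}"
proof -
  have "{1..n} \<in> subsets_of_size n m"
    using nm unfolding subsets_of_size_def by auto
  then have "{{1..n}} \<in> VR n m"
    unfolding VR_iff by simp
  moreover have "\<not> t \<subseteq> {{1..n}}" if "t \<in> gapped n m \<or> t \<in> critical n m" for t
    using card_gapped_or_critical[OF that] card_mono[of "{{1..n}}" t] by auto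
  ultimately show ?thesis
    unfolding ex_in_conv[symmetric] noncritical_VR_iff by blast
qed

lemma VR_wedge_of_spheres:
  "geometric_realization (VR n m) homotopy_equivalent_space wedge_of_spheres (card (critical n m)) 2"
proof -
  have "geometric_realization (VR n m) = top_of_set (polyhedron (VR n m))"
    by (rule geometric_realization_finite[OF finite_complex_VR])
  also have "\<dots> homotopy_equivalent_space top_of_set (polyhedron (ungapped_VR n m))"
    by (rule VR_collapse)
  also have "\<dots> homotopy_equivalent_space wedge_of_spheres (card (critical n m)) 2"
    unfolding ungapped_VR_eq
  proof (rule homotopy_equivalent_wedge_of_spheres)
    show "noncritical_VR n m \<inter> critical n m = {}"
      using noncritical_VR_iff by blast
    show "card t = 3" if "t \<in> critical n m" for t
      using card_gapped_or_critical[of t] that by blast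
    show "\<rho> \<in> noncritical_VR n m" if "t \<in> critical n m" "\<rho> \<subset> t" "\<rho> \<noteq> {}" for t \<rho>
      using that by (rule critical_proper_face)
  qed (rule finite_complex_noncritical_VR noncritical_VR_nonempty contractible_noncritical_VR finite_critical)+
  finally show ?thesis .
qed

end

section \<open>Counting the critical triangles\<close>

definition successor_triples :: "'a::linorder set \<Rightarrow> ('a \<times> 'a \<times> 'a) set" where
  "successor_triples B = {(a, b, c). a \<in> B \<and> b \<in> B \<and> c \<in> B \<and> c < b \<and> b < a \<and> \<not> (\<exists>x\<in>B. b < x \<and> x < a)}"

lemma card_successor_triples:
  fixes B :: "'a::linorder set"
  assumes B: "finite B" "B \<noteq> {}"
  shows "card (successor_triples B) = (card B - 1) choose 2"
proof -
  \<comment> \<open>Forgetting \<open>a\<close> loses nothing, as it is the successor of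
    \<open>b\<close> in \<open>B\<close>. Such a successor exists exactly when \<open>b\<close> is
    not the maximum.\<close>
  let ?P = "{P. P \<subseteq> B - {Max B} \<and> card P = 2}"
  have "bij_betw (\<lambda>(a, b, c). {b, c}) (successor_triples B) ?P"
  proof (intro bij_betw_imageI inj_onI)
    fix s t
    assume s: "s \<in> successor_triples B" and t: "t \<in> successor_triples B"
      and eq: "(\<lambda>(a, b, c). {b, c}) s = (\<lambda>(a, b, c). {b, c}) t"
    obtain a b c a' b' c' where st: "s = (a, b, c)" "t = (a', b', c')"
      by (cases s; cases t) auto
    have "b = b'" "c = c'"
      using s t eq unfolding st successor_triples_def by (auto simp: doubleton_eq_iff)
    moreover have "\<not> a < a'" "\<not> a' < a"
      using s t \<open>b = b'\<close> unfolding st successor_triples_def by blast+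
    then have "a = a'"
      by simp
    ultimately show "s = t"
      unfolding st by simp
  next
    show "(\<lambda>(a, b, c). {b, c}) ` successor_triples B = ?P"
    proof (intro equalityI subsetI)
      fix P
      assume "P \<in> (\<lambda>(a, b, c). {b, c}) ` successor_triples B"
      then obtain a b c where abc: "(a, b, c) \<in> successor_triples B" "P = {b, c}"
        by auto
      then have o: "a \<in> B" "b \<in> B" "c \<in> B" "c < b" "b < a"
        unfolding successor_triples_def by auto
      then have "b < Max B" "c < Max B"
        using Max_ge[OF B(1) o(1)] by auto
      then show "P \<in> ?P"
        using o abc(2) by auto
    next
      fix P
      assume P: "P \<in> ?P"
      then obtain x y where "P = {x, y}" "x \<noteq> y"
        by (auto simp: card_2_iff)
      then obtain b c where bc: "P = {b, c}" "c < b"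
        by (metis insert_commute linorder_neqE)
      have mem: "b \<in> B" "c \<in> B" "b \<noteq> Max B"
        using P bc(1) by auto
      define S where "S = {x \<in> B. b < x}"
      have "b < Max B"
        using Max_ge[OF B(1) mem(1)] mem(3) by simp
      then have "Max B \<in> S"
        using B unfolding S_def by simp
      then have S: "finite S" "S \<noteq> {}"
        using B(1) unfolding S_def by auto
      have "Min S \<in> S"
        using S by simp
      then have "Min S \<in> B" "b < Min S"
        unfolding S_def by blast+
      moreover have "\<not> x < Min S" if "x \<in> B" "b < x" for x
        using S(1) that Min_le[of S x] by (auto simp: S_def not_less)
      ultimately have "(Min S, b, c) \<in> successor_triples B"
        using mem bc(2) unfolding successor_triples_def by auto
      then show "P \<in> (\<lambda>(a, b, c). {b, c}) ` successor_triples B"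
        using bc(1) by (intro image_eqI[of _ _ "(Min S, b, c)"]) auto
    qed
  qed
  then have "card (successor_triples B) = card ?P"
    by (rule bij_betw_same_card)
  also have "\<dots> = (card B - 1) choose 2"
    using B n_subsets[of "B - {Max B}" 2] by (simp add: card_Diff_singleton)
  finally show ?thesis .
qed

lemma card_critical:
  fixes n m :: nat
  assumes nm: "n < m"
  shows "card (critical n m) = (\<Sum>k = 2..n. ((m + k - 1 - n) choose (k + 1)) * (k choose 2))"
proof -
  \<comment> \<open>With \<open>d = m + k - n\<close> as the largest missing element,
    \<open>lower k\<close> ranges over the parts of the \<open>(n + 1)\<close>-sets below
    \<open>d\<close>, and \<open>full\<close> puts back everything above \<open>d\<close>. The bound
    \<open>m + k - 1 - n\<close> is \<open>d - 1\<close>.\<close>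
  define lower where "lower k = {B. B \<subseteq> {1..m + k - 1 - n} \<and> card B = k + 1}" for k
  define Q where "Q = (SIGMA k:{2..n}. SIGMA B:lower k. successor_triples B)"
  define full where "full k B = B \<union> {m + k - n<..m}" for k B
  define g where "g = (\<lambda>(k, B, a, b, c). deletions (full k B) {a, b, c})"
  have fin: "finite B" "B \<noteq> {}" if "B \<in> lower k" for k B
    using that finite_subset[of B "{1..m + k - 1 - n}"] unfolding lower_def by auto
  have below: "B \<subseteq> {..<m + k - n}" "B \<subseteq> {1..m}" "B \<inter> {m + k - n<..m} = {}" if "B \<in> lower k" "k \<le> n" for k B
    using that nm unfolding lower_def by fastforce+
  have full: "full k B \<in> subsets_of_size (Suc n) m" "m + k - n \<notin> full k B" "B = full k B \<inter> {..<m + k - n}"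
    if B: "B \<in> lower k" and k: "k \<le> n" for k B
  proof -
    note b = below[OF B k]
    have "card (full k B) = card B + card {m + k - n<..m}"
      unfolding full_def using b fin(1)[OF B] by (intro card_Un_disjoint) auto
    also have "\<dots> = Suc n"
      using B k nm unfolding lower_def by simp
    finally show "full k B \<in> subsets_of_size (Suc n) m"
      unfolding subsets_of_size_def full_def using b(2) nm by auto
    show "m + k - n \<notin> full k B" "B = full k B \<inter> {..<m + k - n}"
      unfolding full_def using b(1) by auto
  qed
  have triple: "ordered_triple n m (full k B) a b c"
    "\<not> (\<exists>x\<in>full k B. b < x \<and> x < a)" "a < m + k - n"
    if B: "B \<in> lower k" and k: "k \<le> n" and s: "(a, b, c) \<in> successor_triples B" for k B a b c
  proof -
    have s': "a \<in> B" "b \<in> B" "c \<in> B" "c < b" "b < a" "\<not> (\<exists>x\<in>B. b < x \<and> x < a)"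
      using s unfolding successor_triples_def by auto
    show "ordered_triple n m (full k B) a b c"
      unfolding ordered_triple_def using full(1)[OF B k] s' by (simp add: full_def)
    show a: "a < m + k - n"
      using below(1)[OF B k] s'(1) by auto
    show "\<not> (\<exists>x\<in>full k B. b < x \<and> x < a)"
      using s'(6) a unfolding full_def by auto
  qed
  \<comment> \<open>If \<open>k < k'\<close>, the element missing from \<open>full k' B'\<close>
    would lie in the block that \<open>full\<close> adds to \<open>B\<close>. By symmetry the set
    determines \<open>k\<close>.\<close>
  have k_le: "k' \<le> k" if B: "B \<in> lower k" "k \<le> n" and B': "B' \<in> lower k'" "k' \<le> n" and eq: "full k B = full k' B'"
    for k k' B B'
  proof (rule ccontr)
    assume "\<not> k' \<le> k"
    then have "m + k' - n \<in> {m + k - n<..m}"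
      using nm B'(2) by auto
    then show False
      using full(2)[OF B'] eq unfolding full_def by auto
  qed
  have "inj_on g Q"
  proof (rule inj_onI)
    fix s t
    assume sQ: "s \<in> Q" and tQ: "t \<in> Q" and eq: "g s = g t"
    obtain k B a b c k' B' a' b' c' where st: "s = (k, B, a, b, c)" "t = (k', B', a', b', c')"
      by (cases s; cases t) auto
    have s: "B \<in> lower k" "k \<le> n" "(a, b, c) \<in> successor_triples B"
      and t: "B' \<in> lower k'" "k' \<le> n" "(a', b', c') \<in> successor_triples B'"
      using sQ tQ unfolding st Q_def by auto
    note os = triple(1)[OF s] and ot = triple(1)[OF t]
    have deq: "deletions (full k B) {a, b, c} = deletions (full k' B') {a', b', c'}"
      using eq unfolding st g_def by simp
    have F: "full k B = full k' B'" "{a, b, c} \<subseteq> {a', b', c'}"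
      using ordered_triple_deletions_subset[OF os ordered_tripleD(1,2)[OF ot]] deq by simp_all
    have "a = a'" "b = b'" "c = c'"
      using F(2) ordered_tripleD(3,4)[OF os] ordered_tripleD(3,4)[OF ot] by auto
    moreover have "k = k'"
      using k_le[OF s(1,2) t(1,2) F(1)] k_le[OF t(1,2) s(1,2) F(1)[symmetric]] by simp
    moreover have "B = B'"
      using full(3)[OF s(1,2)] full(3)[OF t(1,2)] F(1) \<open>k = k'\<close> by simp
    ultimately show "s = t"
      unfolding st by simp
  qed
  moreover have "g ` Q = critical n m"
  proof (intro equalityI subsetI)
    fix t
    assume "t \<in> g ` Q"
    then obtain k B a b c where q: "(k, B, a, b, c) \<in> Q" and t: "t = deletions (full k B) {a, b, c}"
      unfolding g_def by auto
    have s: "B \<in> lower k" "k \<le> n" "(a, b, c) \<in> successor_triples B"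
      using q unfolding Q_def by auto
    have "m + k - n \<le> m"
      using s(2) by simp
    then show "t \<in> critical n m"
      unfolding critical_def t using triple[OF s] full(2)[OF s(1,2)] by blast
  next
    fix t
    assume "t \<in> critical n m"
    then show "t \<in> g ` Q"
    proof (rule criticalE)
      fix B a b c d0
      assume t: "t = deletions B {a, b, c}" and o: "ordered_triple n m B a b c"
        and nogap: "\<not> (\<exists>x\<in>B. b < x \<and> x < a)" and d0: "d0 \<le> m" "a < d0" "d0 \<notin> B"
      note oD = ordered_tripleD[OF o]
      note BV = subsets_of_sizeD[OF oD(1)]
      \<comment> \<open>The given witness \<open>d0\<close> is replaced by the largest missing
        element, above which \<open>B\<close> is complete.\<close>
      define S where "S = {d. d \<le> m \<and> a < d \<and> d \<notin> B}"
      have S: "finite S" "S \<noteq> {}"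
        using d0 unfolding S_def by auto
      define d where "d = Max S"
      have "d \<in> S" and dmax: "\<And>x. x \<in> S \<Longrightarrow> x \<le> d"
        unfolding d_def using S by auto
      then have d: "d \<le> m" "a < d" "d \<notin> B"
        unfolding S_def by auto
      have top: "x \<in> B" if "d < x" "x \<le> m" for x
        using dmax[of x] that d(2) unfolding S_def by auto
      define B0 where "B0 = {x \<in> B. x < d}"
      have B: "B = B0 \<union> {d<..m}"
      proof (intro equalityI subsetI)
        fix x
        assume "x \<in> B"
        moreover from this have "x \<noteq> d" "x \<le> m"
          using d(3) BV(3) by fastforce+
        ultimately show "x \<in> B0 \<union> {d<..m}"
          unfolding B0_def by auto
      qed (use top in \<open>auto simp: B0_def\<close>)
      have "card B = card B0 + card {d<..m}"
        unfolding B using BV(1) by (intro card_Un_disjoint) (auto simp: B0_def)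
      then have cardB0: "card B0 + (m - d) = Suc n"
        using BV(2) by simp
      have "{a, b, c} \<subseteq> B0"
        using oD(2-4) d(2) unfolding B0_def by auto
      then have "3 \<le> card B0"
        using card_mono[of B0 "{a, b, c}"] oD(5) BV(1) unfolding B0_def by simp
      \<comment> \<open>Solves \<open>d = m + k - n\<close>; counting \<open>B\<close> then gives
        \<open>card B0 = k + 1\<close>. The range of \<open>k\<close> comes from
        \<open>d \<le> m\<close> and from the three labels below \<open>d\<close>.\<close>
      define k where "k = n + d - m"
      have k: "2 \<le> k" "k \<le> n" "m + k - n = d" "m + k - 1 - n = d - 1" "card B0 = k + 1"
        using cardB0 \<open>3 \<le> card B0\<close> d(1) nm unfolding k_def by linarith+
      have "B0 \<subseteq> {1..d - 1}"
        using BV(3) unfolding B0_def by fastforce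
      then have "B0 \<in> lower k"
        using k unfolding lower_def by simp
      moreover have "(a, b, c) \<in> successor_triples B0"
        using \<open>{a, b, c} \<subseteq> B0\<close> oD(3,4) nogap unfolding successor_triples_def B0_def by auto
      ultimately have "(k, B0, a, b, c) \<in> Q"
        using k unfolding Q_def by auto
      moreover have "t = g (k, B0, a, b, c)"
        unfolding t g_def full_def using B k(3) by simp
      ultimately show ?thesis
        by blast
    qed
  qed
  ultimately have "card (critical n m) = card Q"
    using card_image by fastforce
  also have "\<dots> = (\<Sum>k = 2..n. \<Sum>B\<in>lower k. card (successor_triples B))"
  proof -
    have fl: "finite (lower k)" for k
      unfolding lower_def by (rule finite_subset[of _ "Pow {1..m + k - 1 - n}"]) auto
    have fs: "finite (successor_triples B)" if "B \<in> lower k" for k B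
      by (rule finite_subset[of _ "B \<times> B \<times> B"]) (use fin(1)[OF that] in \<open>auto simp: successor_triples_def\<close>)
    show ?thesis
      unfolding Q_def using fl fs by (simp add: card_SigmaI finite_SigmaI)
  qed
  also have "\<dots> = (\<Sum>k = 2..n. ((m + k - 1 - n) choose (k + 1)) * (k choose 2))"
  proof (rule sum.cong[OF refl])
    fix k
    have "card (successor_triples B) = k choose 2" if "B \<in> lower k" for B
      using card_successor_triples[OF fin[OF that]] that by (simp add: lower_def)
    then have "(\<Sum>B\<in>lower k. card (successor_triples B)) = (\<Sum>B\<in>lower k. k choose 2)"
      by simp
    moreover have "card (lower k) = (m + k - 1 - n) choose (k + 1)"
      unfolding lower_def using n_subsets[of "{1..m + k - 1 - n}" "k + 1"] by simp
    ultimately show "(\<Sum>B\<in>lower k. card (successor_triples B)) = ((m + k - 1 - n) choose (k + 1)) * (k choose 2)"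
      by simp
  qed
  finally show ?thesis .
qed

theorem corollary11:
  fixes n m :: nat
  assumes "1 < n" and "n < m - 1"
  shows "geometric_realization (vietoris_rips (subsets_of_size n m) set_distance 2)
           homotopy_equivalent_space
         wedge_of_spheres (\<Sum>k = 2..n. ((m + k - 1 - n) choose (k + 1)) * (k choose 2)) 2"
  using VR_wedge_of_spheres[of n m] card_critical[of n m] assms unfolding VR_def by simp

end
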